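(* Let $V>0$ and $C\ge 0$. Suppose Assumptions A1 and A2 hold, and let the event sequence $\{\omega(0),\omega(1),\omega(2),\ldots\}$ be arbitrary. Consider any $C$-approximate algorithm. Let $B$ be a finite constant satisfying, for all $t$ (and all possible decisions on slot $t$), $$B \ge \tfrac12\sum_{l=1}^L (y_l(t)+g_l(\gamma(t)))^2+\tfrac12\sum_{k=1}^K[b_k(t)^2+a_k(t)^2]+\tfrac12\sum_{m=1}^M(\gamma_m(t)-x_m(t))^2 ,$$ and let $D$ be a finite constant satisfying, for all $t$ and all possible decisions on slot $t$, $$D\ge \tfrac12\sum_{l=1}^L z_l^{diff}|y_l(t)+g_l(\gamma(t))|+\tfrac12\sum_{m=1}^M h_m^{diff}|x_m(t)-\gamma_m(t)|+\tfrac12\sum_{k=1}^K q_k^{diff}\max[b_k(t),a_k(t)] .$$ (Such finite constants exist.) Define $$C_0 = \sqrt{2\left[(B+C)/V+(y_0^{max}-y_0^{min})+(f^{max}-f^{min})\right]} .$$ Then: (a) For any slot $t>0$, $$\sum_{l=1}^L Z_l(t)^2+\sum_{k=1}^K Q_k(t)^2+\sum_{m=1}^M H_m(t)^2\le tVC_0^2+2L(\Theta(0)).$$ In particular, for all $l,k,m$, each of $Z_l(t)$, $Q_k(t)$, $|H_m(t)|$ is at most $\sqrt{tVC_0^2+2L(\Theta(0))}$, which equals $C_0\sqrt{tV}$ if all queues are initially empty. (b) If all queues are initially empty, then for any $t_{end}>0$, with time averages taken over the first $t_{end}$ slots, $$\overline{y}_l+g_l(\overline{x})\le C_0\sqrt{\tfrac{V}{t_{end}}}\Big[1+\sum_{m=1}^M\beta_{l,m}\Big]\quad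 \forall l\in\{1,\ldots,L\},$$ $$\overline{a}_k\le \overline{b}_k+C_0\sqrt{\tfrac{V}{t_{end}}}\quad\forall k\in\{1,\ldots,K\},$$ and there is a vector $\epsilon=(\epsilon_1,\ldots,\epsilon_M)$ with $|\epsilon_m|\le C_0\sqrt{V/t_{end}}$ for all $m$ such that $\overline{x}+\epsilon\in\mathcal{X}$. (c) For any positive integers $T$ and $R$, with $t_{end}=RT$ and time averages taken over the first $t_{end}$ slots, $$\overline{y}_0+f(\overline{x})\le \frac1R\sum_{r=0}^{R-1}F_r^*+\frac{B+C}{V}+\frac{D(T-1)}{V}+\frac{L(\Theta(0))}{VRT}+\sum_{m=1}^M\frac{\nu_m|H_m(RT)-H_m(0)|}{RT}.$$ If all queues are initially empty, the final term satisfies $$\sum_{m=1}^M\frac{\nu_m|H_m(RT)-H_m(0)|}{RT}\le\sum_{m=1}^M\nu_mC_0\sqrt{\frac{V}{RT}}.$$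
   Context: Setting. Time is slotted, $t\in\{0,1,2,\ldots\}$; $K,M,L$ are non-negative integers. $\omega(0),\omega(1),\ldots$ is a sequence of elements of a set $\Omega$ (no probability model). For each $\omega$ there is an action set $\mathcal{A}_\omega$. There are real-valued functions $\hat a_k(\alpha,\omega),\hat b_k(\alpha,\omega)$ ($1\le k\le K$), $\hat x_m(\alpha,\omega)$ ($1\le m\le M$), $\hat y_l(\alpha,\omega)$ ($0\le l\le L$); write $\hat x=(\hat x_1,\ldots,\hat x_M)$. $\mathcal{X}\subseteq\mathbb{R}^M$ is convex. Assumption A1: for all $\omega\in\{\omega(0),\omega(1),\ldots\}$ and all $\alpha\in\mathcal{A}_\omega$: $0\le\hat a_k\le a_k^{max}$, $0\le\hat b_k\le b_k^{max}$, $x_m^{min}\le\hat x_m\le x_m^{max}$, $y_l^{min}\le\hat y_l\le y_l^{max}$ with finite constants. The functions $f$ and $g_1,\ldots,g_L$ are real-valued functions defined on the box $\{x\in\mathbb{R}^M: x_m^{min}\le x_m\le x_m^{max}\ \forall m\}$, with finite lower/upper bounds $f^{min},f^{max}$ and $g_l^{min},g_l^{max}$ there. Cost functions: $f$ and $g_l$ are convex and continuous on the box, and their left and right partial derivatives with respect to $x_m$ are bounded in magnitude by finite constants $\nu_m\ge0$ (for $f$) and $\beta_{l,m}\ge 0$ (for $g_l$) at points of the box with $x_m^{min}<x_m<x_m^{max}$; hence $f(x')\le f(x)+\sum_m\nu_m|x'_m-x_m|$ and $g_l(x')\le g_l(x)+\sum_m\beta_{l,m}|x'_m-x_m|$ for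 $x,x'$ in the box. Assumption A2: for every $\omega\in\{\omega(0),\omega(1),\ldots\}$ there is $\alpha'_\omega\in\mathcal{A}_\omega$ with $\hat y_l(\alpha'_\omega,\omega)+g_l(\hat x(\alpha'_\omega,\omega))\le0$ for $1\le l\le L$, $\hat a_k(\alpha'_\omega,\omega)\le\hat b_k(\alpha'_\omega,\omega)$ for $1\le k\le K$, and $\hat x(\alpha'_\omega,\omega)\in\mathcal{X}$. Decisions. On each slot $t$ one chooses $\alpha(t)\in\mathcal{A}_{\omega(t)}$ and an auxiliary vector $\gamma(t)\in\mathcal{X}$ with $x_m^{min}\le\gamma_m(t)\le x_m^{max}$ for all $m$ (call such a pair feasible). Write $a_k(t)=\hat a_k(\alpha(t),\omega(t))$, and similarly $b_k(t),x_m(t),y_l(t)$. Queues. Initial values $Z_l(0),Q_k(0)\ge0$, $H_m(0)\in\mathbb{R}$; updates $Q_k(t+1)=\max[Q_k(t)-b_k(t),0]+a_k(t)$, $Z_l(t+1)=\max[Z_l(t)+y_l(t)+g_l(\gamma(t)),0]$ ($1\le l\le L$), $H_m(t+1)=H_m(t)+\gamma_m(t)-x_m(t)$. $\Theta(t)$ is the vector of all $Z_l(t),Q_k(t),H_m(t)$, and $L(\Theta(t))=\frac12\sum_lZ_l(t)^2+\frac12\sum_kQ_k(t)^2+\frac12\sum_mH_m(t)^2$. "Initially empty" means all queues are $0$ at $t=0$. Time averages over the first $t_{end}$ slots: $\overline{x}_m=\frac1{t_{end}}\sum_{\tau=0}^{t_{end}-1}x_m(\tau)$, $\overline{x}=(\overline{x}_1,\ldots,\overline{x}_M)$,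 similarly $\overline a_k,\overline b_k,\overline y_l$. $C$-approximate algorithm (parameter $V$): on every slot $t$, given $\omega(t)$ and $\Theta(t)$, it chooses a feasible pair $(\alpha(t),\gamma(t))$ for which the expression $$V\hat y_0(\alpha,\omega(t))+Vf(\gamma)+\sum_lZ_l(t)[\hat y_l(\alpha,\omega(t))+g_l(\gamma)]+\sum_kQ_k(t)[\hat a_k(\alpha,\omega(t))-\hat b_k(\alpha,\omega(t))]+\sum_mH_m(t)[\gamma_m-\hat x_m(\alpha,\omega(t))]$$ is within the additive constant $C\ge0$ of its infimum over all feasible pairs $(\alpha,\gamma)$ on slot $t$. Maximum one-slot changes: $z_l^{diff}=\max[|y_l^{max}+g_l^{max}|,|y_l^{min}+g_l^{min}|]$, $q_k^{diff}=\max[b_k^{max},a_k^{max}]$, $h_m^{diff}=|x_m^{max}-x_m^{min}|$. $T$-slot lookahead cost: for a positive integer $T$ and integer $r\ge0$, $F_r^*$ is the infimum of $h_0+f(\gamma)$ over all $\alpha(\tau)\in\mathcal{A}_{\omega(\tau)}$, $\tau\in\{rT,\ldots,(r+1)T-1\}$, where $\gamma_m=\frac1T\sum_{\tau=rT}^{(r+1)T-1}\hat x_m(\alpha(\tau),\omega(\tau))$ and $h_l=\frac1T\sum_{\tau=rT}^{(r+1)T-1}\hat y_l(\alpha(\tau),\omega(\tau))$, subject to $h_l+g_l(\gamma)\le0$ for $1\le l\le L$, $\gamma\in\mathcal{X}$, and $\frac1T\sum_{\tau=rT}^{(r+1)T-1}[\hat a_k(\alpha(\tau),\omega(\tau))-\hat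 b_k(\alpha(\tau),\omega(\tau))]\le0$ for all $k$. *)

theory Defs
  imports "HOL-Analysis.Analysis"
begin

section \<open>Vectors with \<open>M\<close> real coordinates\<close>

text \<open>
  The number of coordinates may be zero, so \<open>\<real>\<^sup>M\<close> is not represented by a
  type with a finite index type (which would force \<open>M \<ge> 1\<close>), but by the extensional functions
  \<open>{1..M} \<rightarrow>\<^sub>E UNIV\<close>. The type-class topology on \<^typ>\<open>nat \<Rightarrow> real\<close> is the product topology, whose
  restriction to these functions is the usual topology of \<open>\<real>\<^sup>M\<close>.
\<close>

definition vec_convex :: "nat \<Rightarrow> (nat \<Rightarrow> real) set \<Rightarrow> bool" where
  "vec_convex M S \<longleftrightarrow>
     (\<forall>x\<in>S. \<forall>y\<in>S. \<forall>u\<ge>0. \<forall>v\<ge>0. u + v = 1 \<longrightarrow> (\<lambda>m\<in>{1..M}. u * x m + v * y m) \<in> S)"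

definition vec_convex_on :: "nat \<Rightarrow> (nat \<Rightarrow> real) set \<Rightarrow> ((nat \<Rightarrow> real) \<Rightarrow> real) \<Rightarrow> bool" where
  "vec_convex_on M S \<phi> \<longleftrightarrow> vec_convex M S \<and>
     (\<forall>x\<in>S. \<forall>y\<in>S. \<forall>u\<ge>0. \<forall>v\<ge>0. u + v = 1 \<longrightarrow>
        \<phi> (\<lambda>m\<in>{1..M}. u * x m + v * y m) \<le> u * \<phi> x + v * \<phi> y)"

text \<open>
  A one-sided partial derivative in coordinate \<open>m\<close> is a one-sided derivative of the function
  \<open>s \<mapsto> \<phi>(x\<^sub>1, \<dots>, s, \<dots>, x\<^sub>M)\<close>. For a convex \<open>\<phi>\<close> both exist wherever they are
  required to below.
\<close>

definition side_partials_bounded ::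
  "((nat \<Rightarrow> real) \<Rightarrow> real) \<Rightarrow> nat \<Rightarrow> (nat \<Rightarrow> real) \<Rightarrow> real \<Rightarrow> bool" where
  "side_partials_bounded \<phi> m x c \<longleftrightarrow>
     (\<exists>d. ((\<lambda>s. \<phi> (x(m := s))) has_real_derivative d) (at_left (x m)) \<and> \<bar>d\<bar> \<le> c) \<and>
     (\<exists>d. ((\<lambda>s. \<phi> (x(m := s))) has_real_derivative d) (at_right (x m)) \<and> \<bar>d\<bar> \<le> c)"


section \<open>The system\<close>

text \<open>
  \<open>'a\<close> is the type of actions, \<open>'w\<close> the type of random events. Quantities with index \<open>k\<close>, \<open>m\<close>, \<open>l\<close>
  are only meaningful for \<open>1 \<le> k \<le> K\<close>, \<open>1 \<le> m \<le> M\<close> and \<open>1 \<le> l \<le> L\<close>, except that \<open>yhat\<close>,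
  \<open>y_min\<close>, \<open>y_max\<close> also have the index \<open>l = 0\<close>.
\<close>

record ('a, 'w) system =
  numK :: nat
  numM :: nat
  numL :: nat
  event :: "nat \<Rightarrow> 'w"
  action_set :: "'w \<Rightarrow> 'a set"
  ahat :: "nat \<Rightarrow> 'a \<Rightarrow> 'w \<Rightarrow> real"
  bhat :: "nat \<Rightarrow> 'a \<Rightarrow> 'w \<Rightarrow> real"
  xhat :: "nat \<Rightarrow> 'a \<Rightarrow> 'w \<Rightarrow> real"
  yhat :: "nat \<Rightarrow> 'a \<Rightarrow> 'w \<Rightarrow> real"
  Xset :: "(nat \<Rightarrow> real) set"
  costf :: "(nat \<Rightarrow> real) \<Rightarrow> real"
  costg :: "nat \<Rightarrow> (nat \<Rightarrow> real) \<Rightarrow> real"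
  a_max :: "nat \<Rightarrow> real"
  b_max :: "nat \<Rightarrow> real"
  x_min :: "nat \<Rightarrow> real"
  x_max :: "nat \<Rightarrow> real"
  y_min :: "nat \<Rightarrow> real"
  y_max :: "nat \<Rightarrow> real"
  f_min :: real
  f_max :: real
  g_min :: "nat \<Rightarrow> real"
  g_max :: "nat \<Rightarrow> real"
  nu :: "nat \<Rightarrow> real"
  beta :: "nat \<Rightarrow> nat \<Rightarrow> real"

definition xvec :: "('a, 'w) system \<Rightarrow> 'a \<Rightarrow> 'w \<Rightarrow> nat \<Rightarrow> real" where
  "xvec S \<alpha> w = (\<lambda>m\<in>{1..numM S}. xhat S m \<alpha> w)"

definition box_set :: "('a, 'w) system \<Rightarrow> (nat \<Rightarrow> real) set" where
  "box_set S = (\<Pi>\<^sub>E m\<in>{1..numM S}. {x_min S m..x_max S m})"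

definition convex_constraint_set :: "('a, 'w) system \<Rightarrow> bool" where
  "convex_constraint_set S \<longleftrightarrow>
     Xset S \<subseteq> ({1..numM S} \<rightarrow>\<^sub>E UNIV) \<and> vec_convex (numM S) (Xset S)"

definition assumption_A1 :: "('a, 'w) system \<Rightarrow> bool" where
  "assumption_A1 S \<longleftrightarrow>
     (\<forall>w\<in>range (event S). \<forall>\<alpha>\<in>action_set S w.
        (\<forall>k\<in>{1..numK S}. 0 \<le> ahat S k \<alpha> w \<and> ahat S k \<alpha> w \<le> a_max S k) \<and>
        (\<forall>k\<in>{1..numK S}. 0 \<le> bhat S k \<alpha> w \<and> bhat S k \<alpha> w \<le> b_max S k) \<and>
        (\<forall>m\<in>{1..numM S}. x_min S m \<le> xhat S m \<alpha> w \<and> xhat S m \<alpha> w \<le> x_max S m) \<and>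
        (\<forall>l\<in>{0..numL S}. y_min S l \<le> yhat S l \<alpha> w \<and> yhat S l \<alpha> w \<le> y_max S l)) \<and>
     (\<forall>x\<in>box_set S.
        f_min S \<le> costf S x \<and> costf S x \<le> f_max S \<and>
        (\<forall>l\<in>{1..numL S}. g_min S l \<le> costg S l x \<and> costg S l x \<le> g_max S l))"

definition regular_cost ::
  "('a, 'w) system \<Rightarrow> ((nat \<Rightarrow> real) \<Rightarrow> real) \<Rightarrow> (nat \<Rightarrow> real) \<Rightarrow> bool" where
  "regular_cost S \<phi> c \<longleftrightarrow>
     vec_convex_on (numM S) (box_set S) \<phi> \<and>
     continuous_on (box_set S) \<phi> \<and>
     (\<forall>m\<in>{1..numM S}. 0 \<le> c m) \<and>
     (\<forall>m\<in>{1..numM S}. \<forall>x\<in>box_set S.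
        x_min S m < x m \<and> x m < x_max S m \<longrightarrow> side_partials_bounded \<phi> m x (c m))"

definition cost_assumptions :: "('a, 'w) system \<Rightarrow> bool" where
  "cost_assumptions S \<longleftrightarrow>
     regular_cost S (costf S) (nu S) \<and>
     (\<forall>l\<in>{1..numL S}. regular_cost S (costg S l) (beta S l))"

definition assumption_A2 :: "('a, 'w) system \<Rightarrow> bool" where
  "assumption_A2 S \<longleftrightarrow>
     (\<forall>w\<in>range (event S). \<exists>\<alpha>\<in>action_set S w.
        (\<forall>l\<in>{1..numL S}. yhat S l \<alpha> w + costg S l (xvec S \<alpha> w) \<le> 0) \<and>
        (\<forall>k\<in>{1..numK S}. ahat S k \<alpha> w \<le> bhat S k \<alpha> w) \<and>
        xvec S \<alpha> w \<in> Xset S)"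

definition feasible_pairs :: "('a, 'w) system \<Rightarrow> nat \<Rightarrow> ('a \<times> (nat \<Rightarrow> real)) set" where
  "feasible_pairs S t = action_set S (event S t) \<times> (Xset S \<inter> box_set S)"


section \<open>Queues\<close>

record queues =
  Zq :: "nat \<Rightarrow> real"
  Qq :: "nat \<Rightarrow> real"
  Hq :: "nat \<Rightarrow> real"

definition queue_dynamics ::
  "('a, 'w) system \<Rightarrow> (nat \<Rightarrow> 'a) \<Rightarrow> (nat \<Rightarrow> nat \<Rightarrow> real) \<Rightarrow> (nat \<Rightarrow> queues) \<Rightarrow> bool" where
  "queue_dynamics S \<alpha> \<gamma> \<Theta> \<longleftrightarrow>
     (\<forall>l\<in>{1..numL S}. 0 \<le> Zq (\<Theta> 0) l) \<and>
     (\<forall>k\<in>{1..numK S}. 0 \<le> Qq (\<Theta> 0) k) \<and>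
     (\<forall>t.
        (\<forall>k\<in>{1..numK S}. Qq (\<Theta> (t + 1)) k =
           max (Qq (\<Theta> t) k - bhat S k (\<alpha> t) (event S t)) 0 + ahat S k (\<alpha> t) (event S t)) \<and>
        (\<forall>l\<in>{1..numL S}. Zq (\<Theta> (t + 1)) l =
           max (Zq (\<Theta> t) l + yhat S l (\<alpha> t) (event S t) + costg S l (\<gamma> t)) 0) \<and>
        (\<forall>m\<in>{1..numM S}. Hq (\<Theta> (t + 1)) m =
           Hq (\<Theta> t) m + \<gamma> t m - xhat S m (\<alpha> t) (event S t)))"

definition all_queues_empty :: "('a, 'w) system \<Rightarrow> queues \<Rightarrow> bool" where
  "all_queues_empty S \<theta> \<longleftrightarrow>
     (\<forall>l\<in>{1..numL S}. Zq \<theta> l = 0) \<and> (\<forall>k\<in>{1..numK S}. Qq \<theta> k = 0) \<and>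
     (\<forall>m\<in>{1..numM S}. Hq \<theta> m = 0)"

definition lyapunov :: "('a, 'w) system \<Rightarrow> queues \<Rightarrow> real" where
  "lyapunov S \<theta> =
     1/2 * (\<Sum>l\<in>{1..numL S}. (Zq \<theta> l)\<^sup>2) + 1/2 * (\<Sum>k\<in>{1..numK S}. (Qq \<theta> k)\<^sup>2) +
     1/2 * (\<Sum>m\<in>{1..numM S}. (Hq \<theta> m)\<^sup>2)"


section \<open>\<open>C\<close>-approximate algorithms\<close>

definition decision_cost ::
  "('a, 'w) system \<Rightarrow> real \<Rightarrow> nat \<Rightarrow> queues \<Rightarrow> 'a \<Rightarrow> (nat \<Rightarrow> real) \<Rightarrow> real" where
  "decision_cost S V t \<theta> \<alpha> \<gamma> = (let w = event S t in
     V * yhat S 0 \<alpha> w + V * costf S \<gamma> +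
     (\<Sum>l\<in>{1..numL S}. Zq \<theta> l * (yhat S l \<alpha> w + costg S l \<gamma>)) +
     (\<Sum>k\<in>{1..numK S}. Qq \<theta> k * (ahat S k \<alpha> w - bhat S k \<alpha> w)) +
     (\<Sum>m\<in>{1..numM S}. Hq \<theta> m * (\<gamma> m - xhat S m \<alpha> w)))"

text \<open>
  Under \<^const>\<open>assumption_A1\<close> and \<^const>\<open>assumption_A2\<close> the infimum is over a nonempty set that is
  bounded below, hence a genuine infimum.
\<close>

definition C_approximate ::
  "('a, 'w) system \<Rightarrow> real \<Rightarrow> real \<Rightarrow> (nat \<Rightarrow> 'a) \<Rightarrow> (nat \<Rightarrow> nat \<Rightarrow> real) \<Rightarrow> (nat \<Rightarrow> queues) \<Rightarrow> bool"
where
  "C_approximate S V C \<alpha> \<gamma> \<Theta> \<longleftrightarrow>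
     (\<forall>t. (\<alpha> t, \<gamma> t) \<in> feasible_pairs S t \<and>
          decision_cost S V t (\<Theta> t) (\<alpha> t) (\<gamma> t)
            \<le> (INF (\<alpha>', \<gamma>')\<in>feasible_pairs S t. decision_cost S V t (\<Theta> t) \<alpha>' \<gamma>') + C)"


section \<open>Constants\<close>

definition z_diff :: "('a, 'w) system \<Rightarrow> nat \<Rightarrow> real" where
  "z_diff S l = max \<bar>y_max S l + g_max S l\<bar> \<bar>y_min S l + g_min S l\<bar>"

definition q_diff :: "('a, 'w) system \<Rightarrow> nat \<Rightarrow> real" where
  "q_diff S k = max (b_max S k) (a_max S k)"

definition h_diff :: "('a, 'w) system \<Rightarrow> nat \<Rightarrow> real" where
  "h_diff S m = \<bar>x_max S m - x_min S m\<bar>"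

definition valid_B :: "('a, 'w) system \<Rightarrow> real \<Rightarrow> bool" where
  "valid_B S B \<longleftrightarrow> (\<forall>t. \<forall>(\<alpha>, \<gamma>)\<in>feasible_pairs S t. let w = event S t in
     B \<ge> 1/2 * (\<Sum>l\<in>{1..numL S}. (yhat S l \<alpha> w + costg S l \<gamma>)\<^sup>2) +
         1/2 * (\<Sum>k\<in>{1..numK S}. (bhat S k \<alpha> w)\<^sup>2 + (ahat S k \<alpha> w)\<^sup>2) +
         1/2 * (\<Sum>m\<in>{1..numM S}. (\<gamma> m - xhat S m \<alpha> w)\<^sup>2))"

definition valid_D :: "('a, 'w) system \<Rightarrow> real \<Rightarrow> bool" where
  "valid_D S D \<longleftrightarrow> (\<forall>t. \<forall>(\<alpha>, \<gamma>)\<in>feasible_pairs S t. let w = event S t in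
     D \<ge> 1/2 * (\<Sum>l\<in>{1..numL S}. z_diff S l * \<bar>yhat S l \<alpha> w + costg S l \<gamma>\<bar>) +
         1/2 * (\<Sum>m\<in>{1..numM S}. h_diff S m * \<bar>xhat S m \<alpha> w - \<gamma> m\<bar>) +
         1/2 * (\<Sum>k\<in>{1..numK S}. q_diff S k * max (bhat S k \<alpha> w) (ahat S k \<alpha> w)))"


section \<open>Time averages and lookahead\<close>

definition time_avg :: "nat \<Rightarrow> (nat \<Rightarrow> real) \<Rightarrow> real" where
  "time_avg n u = 1 / real n * (\<Sum>\<tau><n. u \<tau>)"

definition xbar :: "('a, 'w) system \<Rightarrow> (nat \<Rightarrow> 'a) \<Rightarrow> nat \<Rightarrow> nat \<Rightarrow> real" where
  "xbar S \<alpha> n = (\<lambda>m\<in>{1..numM S}. time_avg n (\<lambda>\<tau>. xhat S m (\<alpha> \<tau>) (event S \<tau>)))"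

definition ybar :: "('a, 'w) system \<Rightarrow> (nat \<Rightarrow> 'a) \<Rightarrow> nat \<Rightarrow> nat \<Rightarrow> real" where
  "ybar S \<alpha> n l = time_avg n (\<lambda>\<tau>. yhat S l (\<alpha> \<tau>) (event S \<tau>))"

definition abar :: "('a, 'w) system \<Rightarrow> (nat \<Rightarrow> 'a) \<Rightarrow> nat \<Rightarrow> nat \<Rightarrow> real" where
  "abar S \<alpha> n k = time_avg n (\<lambda>\<tau>. ahat S k (\<alpha> \<tau>) (event S \<tau>))"

definition bbar :: "('a, 'w) system \<Rightarrow> (nat \<Rightarrow> 'a) \<Rightarrow> nat \<Rightarrow> nat \<Rightarrow> real" where
  "bbar S \<alpha> n k = time_avg n (\<lambda>\<tau>. bhat S k (\<alpha> \<tau>) (event S \<tau>))"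

definition frame_avg :: "nat \<Rightarrow> nat \<Rightarrow> (nat \<Rightarrow> real) \<Rightarrow> real" where
  "frame_avg T r u = 1 / real T * (\<Sum>\<tau>\<in>{r * T..<(r + 1) * T}. u \<tau>)"

definition frame_x :: "('a, 'w) system \<Rightarrow> nat \<Rightarrow> nat \<Rightarrow> (nat \<Rightarrow> 'a) \<Rightarrow> nat \<Rightarrow> real" where
  "frame_x S T r \<alpha> = (\<lambda>m\<in>{1..numM S}. frame_avg T r (\<lambda>\<tau>. xhat S m (\<alpha> \<tau>) (event S \<tau>)))"

definition frame_y :: "('a, 'w) system \<Rightarrow> nat \<Rightarrow> nat \<Rightarrow> (nat \<Rightarrow> 'a) \<Rightarrow> nat \<Rightarrow> real" where
  "frame_y S T r \<alpha> l = frame_avg T r (\<lambda>\<tau>. yhat S l (\<alpha> \<tau>) (event S \<tau>))"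

text \<open>
  Only the values of \<open>\<alpha>\<close> on the slots of frame \<open>r\<close> matter.
\<close>

definition lookahead_feasible :: "('a, 'w) system \<Rightarrow> nat \<Rightarrow> nat \<Rightarrow> (nat \<Rightarrow> 'a) \<Rightarrow> bool" where
  "lookahead_feasible S T r \<alpha> \<longleftrightarrow>
     (\<forall>\<tau>\<in>{r * T..<(r + 1) * T}. \<alpha> \<tau> \<in> action_set S (event S \<tau>)) \<and>
     (\<forall>l\<in>{1..numL S}. frame_y S T r \<alpha> l + costg S l (frame_x S T r \<alpha>) \<le> 0) \<and>
     frame_x S T r \<alpha> \<in> Xset S \<and>
     (\<forall>k\<in>{1..numK S}.
        frame_avg T r (\<lambda>\<tau>. ahat S k (\<alpha> \<tau>) (event S \<tau>) - bhat S k (\<alpha> \<tau>) (event S \<tau>)) \<le> 0)"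

text \<open>
  For \<open>T > 0\<close> this is again a genuine infimum: per-slot actions as in \<^const>\<open>assumption_A2\<close> are
  feasible by convexity, and \<^const>\<open>assumption_A1\<close> bounds the cost from below.
\<close>

definition F_star :: "('a, 'w) system \<Rightarrow> nat \<Rightarrow> nat \<Rightarrow> real" where
  "F_star S T r =
     (INF \<alpha>\<in>{\<alpha>. lookahead_feasible S T r \<alpha>}. frame_y S T r \<alpha> 0 + costf S (frame_x S T r \<alpha>))"

end

theory Submission
  imports Defs
begin

text \<open>
  With \<open>L(\<Theta>)\<close> as Lyapunov function, the expression minimised by the algorithm is, up to the
  constant \<open>B\<close>, an upper bound for \<open>L(\<Theta>(t+1)) - L(\<Theta>(t)) + V (y\<^sub>0(t) + f(\<gamma>(t)))\<close>.
  Comparing the algorithm with the action of A2, whose queue terms are nonpositive, bounds the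
  growth of \<open>L\<close> linearly in time. The queues dominate the accumulated constraint violations, and
  Jensen's inequality and the Lipschitz bounds pass from \<open>\<gamma>\<close> to the time averages of \<open>x\<close>. For
  the cost, the competitor is a lookahead-feasible choice of actions together with the constant
  auxiliary vector equal to its frame average: freezing the queues at the start of the frame makes
  the queue terms sum to something nonpositive, and freezing costs at most \<open>2 j D\<close> on the
  \<open>j\<close>-th slot (counting from \<open>0\<close>), hence \<open>D T (T - 1)\<close> per frame.
\<close>

section \<open>Convex functions of finitely many coordinates\<close>

text \<open>Jensen's inequality with equal weights, by induction on the number of points: the mean
  of n + 1 points combines the new point with weight 1/(n + 1) and the mean of the other n with
  weight n/(n + 1). Membership is carried along because the convexity hypothesis speaks only of
  points of \<open>A\<close>.\<close>

lemma vec_convex_on_mean: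
  assumes \<phi>: "vec_convex_on M A \<phi>" and A: "A \<subseteq> {1..M} \<rightarrow>\<^sub>E UNIV"
    and I: "finite I" "I \<noteq> {}" and p: "\<And>i. i \<in> I \<Longrightarrow> p i \<in> A"
  shows "(\<lambda>m\<in>{1..M}. 1 / real (card I) * (\<Sum>i\<in>I. p i m)) \<in> A \<and>
    \<phi> (\<lambda>m\<in>{1..M}. 1 / real (card I) * (\<Sum>i\<in>I. p i m)) \<le> 1 / real (card I) * (\<Sum>i\<in>I. \<phi> (p i))"
  using I p
proof (induction I rule: finite_ne_induct)
  case (singleton i)
  \<comment> \<open>Means are restricted functions, so a one-point mean is the point itself only
    because that point is extensional.\<close>
  have "p i \<in> {1..M} \<rightarrow>\<^sub>E UNIV" using A singleton by blast
  then have "(\<lambda>m\<in>{1..M}. p i m) = p i" by (auto simp: PiE_def extensional_def restrict_def)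
  then show ?case using singleton by simp
next
  case (insert i I)
  define n where "n = real (card I)"
  have n: "n > 0" unfolding n_def using insert by (simp add: card_gt_0_iff)
  have card: "real (card (insert i I)) = n + 1" unfolding n_def using insert by simp
  define q where "q = (\<lambda>m\<in>{1..M}. 1 / n * (\<Sum>i\<in>I. p i m))"
  have IH: "q \<in> A" "\<phi> q \<le> 1 / n * (\<Sum>i\<in>I. \<phi> (p i))"
    using insert.IH[OF insert.prems] unfolding q_def n_def by (simp_all only: insertI2)
  have pi: "p i \<in> A" using insert.prems by blast
  have uv: "0 \<le> 1 / (n + 1)" "0 \<le> n / (n + 1)" "1 / (n + 1) + n / (n + 1) = 1"
    using n by (auto simp: field_simps)
  have cancel: "n / (n + 1) * (1 / n * u) = 1 / (n + 1) * u" for u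
    using n by (simp add: divide_simps)
  have eq: "(\<lambda>m\<in>{1..M}. 1 / real (card (insert i I)) * (\<Sum>i\<in>insert i I. p i m))
      = (\<lambda>m\<in>{1..M}. 1 / (n + 1) * p i m + n / (n + 1) * q m)"
    unfolding card q_def using insert.hyps by (intro restrict_ext) (simp only: cancel distrib_left sum.insert not_False_eq_True restrict_apply')
  have mem: "(\<lambda>m\<in>{1..M}. 1 / (n + 1) * p i m + n / (n + 1) * q m) \<in> A"
    using \<phi> pi IH(1) uv unfolding vec_convex_on_def vec_convex_def by blast
  have "\<phi> (\<lambda>m\<in>{1..M}. 1 / (n + 1) * p i m + n / (n + 1) * q m)
      \<le> 1 / (n + 1) * \<phi> (p i) + n / (n + 1) * \<phi> q"
    using \<phi> pi IH(1) uv unfolding vec_convex_on_def by blast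
  also have "\<dots> \<le> 1 / (n + 1) * \<phi> (p i) + n / (n + 1) * (1 / n * (\<Sum>i\<in>I. \<phi> (p i)))"
    using IH(2) uv(2) by (intro add_left_mono mult_left_mono)
  also have "\<dots> = 1 / real (card (insert i I)) * (\<Sum>i\<in>insert i I. \<phi> (p i))"
    unfolding card using insert.hyps by (simp only: cancel distrib_left sum.insert not_False_eq_True restrict_apply')
  finally show ?case using mem unfolding eq by blast
qed

text \<open>The zero function is convex on every convex set, so Jensen's inequality specialises to
  its membership half.\<close>

lemma vec_convex_mean:
  assumes "vec_convex M A" "A \<subseteq> {1..M} \<rightarrow>\<^sub>E UNIV" "finite I" "I \<noteq> {}" "\<And>i. i \<in> I \<Longrightarrow> p i \<in> A"
  shows "(\<lambda>m\<in>{1..M}. 1 / real (card I) * (\<Sum>i\<in>I. p i m)) \<in> A"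
  using vec_convex_on_mean[of M A "\<lambda>_. 0" I p] assms unfolding vec_convex_on_def by simp

text \<open>Secant slopes of a convex function with right end \<open>t\<close> increase with the
  left end, and their limit is the left derivative at \<open>t\<close>.\<close>

lemma convex_on_slope_le_left_deriv:
  fixes h :: "real \<Rightarrow> real"
  assumes h: "convex_on A h" "s \<in> A" "t \<in> A" "s < t"
    and d: "(h has_real_derivative d) (at_left t)"
  shows "(h t - h s) / (t - s) \<le> d"
proof -
  have lim: "((\<lambda>y. (h y - h t) / (y - t)) \<longlongrightarrow> d) (at_left t)"
    using d by (simp add: has_field_derivative_iff)
  have "eventually (\<lambda>y. y \<in> {s<..<t}) (at_left t)"
    by (rule eventually_at_leftI[OF _ h(4)])
  then have "eventually (\<lambda>y. (h t - h s) / (t - s) \<le> (h y - h t) / (y - t)) (at_left t)"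
  proof eventually_elim
    case (elim y)
    have "(h s - h t) / (s - t) \<le> (h y - h t) / (y - t)"
      using convex_on_slope_le(2)[OF h(1,2,3), of y] elim by simp
    moreover have "(h s - h t) / (s - t) = (h t - h s) / (t - s)"
      by (metis minus_diff_eq minus_divide_divide)
    ultimately show ?case by simp
  qed
  then show ?thesis by (intro tendsto_lowerbound[OF lim]) auto
qed

text \<open>Mirror image: with left end \<open>s\<close> fixed, the slopes decrease to the right
  derivative as the right end approaches \<open>s\<close>.\<close>

lemma convex_on_slope_ge_right_deriv:
  fixes h :: "real \<Rightarrow> real"
  assumes h: "convex_on A h" "s \<in> A" "t \<in> A" "s < t"
    and d: "(h has_real_derivative d) (at_right s)"
  shows "d \<le> (h t - h s) / (t - s)"
proof -
  have lim: "((\<lambda>y. (h y - h s) / (y - s)) \<longlongrightarrow> d) (at_right s)"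
    using d by (simp add: has_field_derivative_iff)
  have "eventually (\<lambda>y. y \<in> {s<..<t}) (at_right s)"
    by (rule eventually_at_rightI[OF _ h(4)])
  then have "eventually (\<lambda>y. (h y - h s) / (y - s) \<le> (h t - h s) / (t - s)) (at_right s)"
  proof eventually_elim
    case (elim y)
    have "(h s - h y) / (s - y) \<le> (h s - h t) / (s - t)"
      using convex_on_slope_le(1)[OF h(1,2,3), of y] elim by simp
    then show ?case by (metis minus_diff_eq minus_divide_divide)
  qed
  then show ?thesis by (intro tendsto_upperbound[OF lim]) auto
qed

text \<open>Derivatives are controlled only in the open interval. There each secant slope lies
  between the right derivative at its left end and the left derivative at its right end; continuity
  extends the estimate to the closed interval.\<close>

lemma convex_on_Icc_lipschitz:
  fixes h :: "real \<Rightarrow> real"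
  assumes h: "convex_on {a..b} h" "continuous_on {a..b} h" and c: "0 \<le> c"
    and left: "\<And>s. a < s \<Longrightarrow> s < b \<Longrightarrow> \<exists>d. (h has_real_derivative d) (at_left s) \<and> \<bar>d\<bar> \<le> c"
    and right: "\<And>s. a < s \<Longrightarrow> s < b \<Longrightarrow> \<exists>d. (h has_real_derivative d) (at_right s) \<and> \<bar>d\<bar> \<le> c"
  shows "c-lipschitz_on {a..b} h"
proof (cases "a < b")
  case True
  have *: "\<bar>h t - h s\<bar> \<le> c * (t - s)" if st: "a < s" "s < t" "t < b" for s t
  proof -
    obtain d where d: "(h has_real_derivative d) (at_left t)" "\<bar>d\<bar> \<le> c"
      using left[of t] st by auto
    obtain e where e: "(h has_real_derivative e) (at_right s)" "\<bar>e\<bar> \<le> c"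
      using right[of s] st by auto
    have "(h t - h s) / (t - s) \<le> d" "e \<le> (h t - h s) / (t - s)"
      using convex_on_slope_le_left_deriv[OF h(1) _ _ st(2) d(1)]
        convex_on_slope_ge_right_deriv[OF h(1) _ _ st(2) e(1)] st by auto
    then have "\<bar>(h t - h s) / (t - s)\<bar> \<le> c" using d e by linarith
    then show ?thesis using st by (simp add: abs_divide divide_le_eq)
  qed
  have "c-lipschitz_on {a<..<b} h"
  proof (rule lipschitz_onI)
    fix s t assume "s \<in> {a<..<b}" "t \<in> {a<..<b}"
    then show "dist (h s) (h t) \<le> c * dist s t"
      using *[of s t] *[of t s] by (cases s t rule: linorder_cases) (auto simp: dist_real_def abs_minus_commute)
  qed (rule c)
  then show ?thesis
    using lipschitz_on_closure[of c "{a<..<b}" h] h(2) True by simp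
next
  case False
  then have "s = t" if "s \<in> {a..b}" "t \<in> {a..b}" for s t using that by auto
  then show ?thesis using c by (intro lipschitz_onI) (metis dist_self mult_zero_right order_refl)
qed

text \<open>Along a line parallel to a coordinate axis the cost is a convex continuous function of
  one variable. The bound on the partial derivatives is invoked at the points
  \<open>x(m := t)\<close> with \<open>t\<close> interior, so \<open>x\<close> itself may lie on the
  boundary of the box.\<close>

lemma regular_cost_lipschitz_coord:
  assumes \<phi>: "regular_cost S \<phi> c" and m: "m \<in> {1..numM S}" and x: "x \<in> box_set S"
    and s: "s \<in> {x_min S m..x_max S m}"
  shows "\<bar>\<phi> (x(m := s)) - \<phi> x\<bar> \<le> c m * \<bar>s - x m\<bar>"
proof -
  have box: "x(m := t) \<in> box_set S" if "t \<in> {x_min S m..x_max S m}" for t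
    using x m that unfolding box_set_def by (fastforce simp: PiE_iff extensional_def)
  have xm: "x m \<in> {x_min S m..x_max S m}" using x m unfolding box_set_def by (rule PiE_mem)
  define h where "h = (\<lambda>t. \<phi> (x(m := t)))"
  have "convex_on {x_min S m..x_max S m} h"
  proof (rule convex_onI)
    fix t p q :: real
    assume t: "0 < t" "t < 1" and pq: "p \<in> {x_min S m..x_max S m}" "q \<in> {x_min S m..x_max S m}"
    \<comment> \<open>Off coordinate \<open>m\<close> both points agree with \<open>x\<close>, hence
      so does their convex combination.\<close>
    have eq: "(\<lambda>i\<in>{1..numM S}. (1 - t) * (x(m := p)) i + t * (x(m := q)) i)
        = x(m := (1 - t) * p + t * q)"
      using x m unfolding box_set_def by (auto simp: fun_eq_iff PiE_iff extensional_def algebra_simps)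
    have "\<phi> (\<lambda>i\<in>{1..numM S}. (1 - t) * (x(m := p)) i + t * (x(m := q)) i)
        \<le> (1 - t) * \<phi> (x(m := p)) + t * \<phi> (x(m := q))"
      using \<phi> box[OF pq(1)] box[OF pq(2)] t unfolding regular_cost_def vec_convex_on_def
      by (simp del: fun_upd_apply)
    then show "h ((1 - t) *\<^sub>R p + t *\<^sub>R q) \<le> (1 - t) * h p + t * h q"
      unfolding h_def eq by simp
  qed simp
  moreover have "continuous_on {x_min S m..x_max S m} h"
    unfolding h_def
  proof (rule continuous_on_compose2[of "box_set S" \<phi>])
    show "continuous_on {x_min S m..x_max S m} (\<lambda>t. x(m := t))"
    proof (rule continuous_on_coordinatewise_then_product)
      show "continuous_on {x_min S m..x_max S m} (\<lambda>t. (x(m := t)) i)" for i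
        by (cases "i = m") simp_all
    qed
  qed (use \<phi> box in \<open>auto simp: regular_cost_def\<close>)
  moreover have "side_partials_bounded \<phi> m (x(m := t)) (c m)"
    if "x_min S m < t" "t < x_max S m" for t
    using \<phi> m box[of t] that unfolding regular_cost_def by auto
  moreover have "0 \<le> c m" using \<phi> m unfolding regular_cost_def by blast
  ultimately have "(c m)-lipschitz_on {x_min S m..x_max S m} h"
    by (intro convex_on_Icc_lipschitz) (auto simp: side_partials_bounded_def h_def)
  from lipschitz_onD[OF this s xm] show ?thesis by (simp add: h_def dist_real_def)
qed

text \<open>Coordinates are exchanged one at a time: the intermediate point \<open>w j\<close> has
  the first \<open>j\<close> coordinates of \<open>x'\<close> and the others of \<open>x\<close>,
  and it stays in the box because the box is a product.\<close>

lemma regular_cost_lipschitz: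
  assumes \<phi>: "regular_cost S \<phi> c" and x: "x \<in> box_set S" and x': "x' \<in> box_set S"
  shows "\<phi> x' \<le> \<phi> x + (\<Sum>m\<in>{1..numM S}. c m * \<bar>x' m - x m\<bar>)"
proof -
  define w where "w = (\<lambda>j i. if i \<in> {1..j} then x' i else x i :: real)"
  have wbox: "w j \<in> box_set S" if "j \<le> numM S" for j
    using x x' that unfolding w_def box_set_def by (auto simp: PiE_iff extensional_def)
  have "\<phi> (w j) \<le> \<phi> x + (\<Sum>m\<in>{1..j}. c m * \<bar>x' m - x m\<bar>)" if "j \<le> numM S" for j
    using that
  proof (induction j)
    case 0
    have "w 0 = x" by (auto simp: w_def)
    then show ?case by simp
  next
    case (Suc j)
    have upd: "w (Suc j) = (w j)(Suc j := x' (Suc j))" by (auto simp: w_def fun_eq_iff)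
    have "x' (Suc j) \<in> {x_min S (Suc j)..x_max S (Suc j)}"
      using x' Suc.prems unfolding box_set_def by (intro PiE_mem[of x' _ "\<lambda>m. {x_min S m..x_max S m}"]) auto
    from regular_cost_lipschitz_coord[OF \<phi> _ wbox this, of j] Suc.prems
    have "\<phi> (w (Suc j)) \<le> \<phi> (w j) + c (Suc j) * \<bar>x' (Suc j) - x (Suc j)\<bar>"
      unfolding upd by (simp add: w_def)
    then show ?case using Suc by simp
  qed
  moreover have "w (numM S) = x'"
    using x x' unfolding w_def box_set_def by (auto simp: fun_eq_iff PiE_iff extensional_def)
  ultimately show ?thesis by fastforce
qed

section \<open>Drift\<close>

text \<open>With parameter 0 only the terms weighted by queues remain;
  \<open>decision_cost S 0\<close> serves from here on as the name of that part.\<close>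

lemma decision_cost_split:
  "decision_cost S V t \<theta> a g
    = V * yhat S 0 a (event S t) + V * costf S g + decision_cost S 0 t \<theta> a g"
  by (simp add: decision_cost_def Let_def)

lemma mult_ge_neg_abs_mult:
  fixes z u d :: real
  assumes "\<bar>u\<bar> \<le> d"
  shows "- (\<bar>z\<bar> * d) \<le> z * u"
proof -
  have "\<bar>z * u\<bar> \<le> \<bar>z\<bar> * d" using assms by (simp add: abs_mult mult_left_mono)
  then show ?thesis by linarith
qed

text \<open>In the cross term \<open>2 * a * max (q - b) 0\<close> the maximum is replaced by
  \<open>q\<close>, so no product of \<open>a\<close> and \<open>b\<close> remains. This matches the
  separate squares of \<open>a\<close> and \<open>b\<close> in \<open>valid_B\<close>.\<close>

lemma queue_square_drift:
  fixes q a b :: real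
  assumes "0 \<le> q" "0 \<le> a" "0 \<le> b"
  shows "(max (q - b) 0 + a)\<^sup>2 \<le> q\<^sup>2 + b\<^sup>2 + a\<^sup>2 + 2 * (q * (a - b))"
proof -
  have "max (q - b) 0 \<le> q" using assms by auto
  then have "max (q - b) 0 * a \<le> q * a" using assms(2) by (rule mult_right_mono)
  moreover have "(max (q - b) 0)\<^sup>2 \<le> (q - b)\<^sup>2" by (auto simp: max_def)
  ultimately show ?thesis by (simp add: power2_eq_square algebra_simps)
qed

section \<open>One run of the algorithm and bounds within a single slot\<close>

locale approximate_run =
  fixes S :: "('a, 'w) system" and V C :: real and \<alpha> :: "nat \<Rightarrow> 'a"
    and \<gamma> :: "nat \<Rightarrow> nat \<Rightarrow> real" and \<Theta> :: "nat \<Rightarrow> queues"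
  assumes V: "V > 0" and C: "C \<ge> 0"
    and X: "convex_constraint_set S"
    and A1: "assumption_A1 S"
    and costs: "cost_assumptions S"
    and A2: "assumption_A2 S"
    and dyn: "queue_dynamics S \<alpha> \<gamma> \<Theta>"
    and approx: "C_approximate S V C \<alpha> \<gamma> \<Theta>"
begin

lemma feasible: "(\<alpha> t, \<gamma> t) \<in> feasible_pairs S t"
  using approx unfolding C_approximate_def by blast

lemma Xset_extensional: "Xset S \<subseteq> {1..numM S} \<rightarrow>\<^sub>E UNIV"
  using X unfolding convex_constraint_set_def by blast

lemma box_extensional: "box_set S \<subseteq> {1..numM S} \<rightarrow>\<^sub>E UNIV"
  unfolding box_set_def by (intro PiE_mono) auto

lemma Xset_convex: "vec_convex (numM S) (Xset S)"
  using X unfolding convex_constraint_set_def by blast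

lemma costf_convex: "vec_convex_on (numM S) (box_set S) (costf S)"
  using costs unfolding cost_assumptions_def regular_cost_def by blast

lemma costg_convex: "l \<in> {1..numL S} \<Longrightarrow> vec_convex_on (numM S) (box_set S) (costg S l)"
  using costs unfolding cost_assumptions_def regular_cost_def by blast

lemma action_bounds:
  assumes "a \<in> action_set S (event S t)"
  shows "k \<in> {1..numK S} \<Longrightarrow> 0 \<le> ahat S k a (event S t)"
    and "k \<in> {1..numK S} \<Longrightarrow> ahat S k a (event S t) \<le> a_max S k"
    and "k \<in> {1..numK S} \<Longrightarrow> 0 \<le> bhat S k a (event S t)"
    and "k \<in> {1..numK S} \<Longrightarrow> bhat S k a (event S t) \<le> b_max S k"
    and "m \<in> {1..numM S} \<Longrightarrow> x_min S m \<le> xhat S m a (event S t)"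
    and "m \<in> {1..numM S} \<Longrightarrow> xhat S m a (event S t) \<le> x_max S m"
    and "l \<in> {0..numL S} \<Longrightarrow> y_min S l \<le> yhat S l a (event S t)"
    and "l \<in> {0..numL S} \<Longrightarrow> yhat S l a (event S t) \<le> y_max S l"
  using A1 assms unfolding assumption_A1_def by blast+

lemma cost_bounds:
  assumes "g \<in> box_set S"
  shows "f_min S \<le> costf S g" and "costf S g \<le> f_max S"
    and "l \<in> {1..numL S} \<Longrightarrow> g_min S l \<le> costg S l g"
    and "l \<in> {1..numL S} \<Longrightarrow> costg S l g \<le> g_max S l"
  using A1 assms unfolding assumption_A1_def by blast+

lemma xvec_box: "a \<in> action_set S (event S t) \<Longrightarrow> xvec S a (event S t) \<in> box_set S"
  using action_bounds(5,6) unfolding xvec_def box_set_def by auto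

text \<open>A number in an interval is bounded in absolute value by the larger absolute value of the
  end points, and two nonnegative numbers differ by at most the larger one. The bound for
  \<open>Q\<close> comes in two halves because \<open>valid_D\<close> multiplies
  \<open>q_diff\<close> by the maximum on the slot, not by \<open>q_diff\<close> again.\<close>

lemma change_bounds:
  assumes "(a, g) \<in> feasible_pairs S t"
  shows "l \<in> {1..numL S} \<Longrightarrow> \<bar>yhat S l a (event S t) + costg S l g\<bar> \<le> z_diff S l"
    and "k \<in> {1..numK S} \<Longrightarrow> max (bhat S k a (event S t)) (ahat S k a (event S t)) \<le> q_diff S k"
    and "k \<in> {1..numK S} \<Longrightarrow> \<bar>ahat S k a (event S t) - bhat S k a (event S t)\<bar>
           \<le> max (bhat S k a (event S t)) (ahat S k a (event S t))"
    and "m \<in> {1..numM S} \<Longrightarrow> \<bar>g m - xhat S m a (event S t)\<bar> \<le> h_diff S m"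
proof -
  have a: "a \<in> action_set S (event S t)" and g: "g \<in> box_set S"
    using assms unfolding feasible_pairs_def by auto
  show "\<bar>yhat S l a (event S t) + costg S l g\<bar> \<le> z_diff S l" if "l \<in> {1..numL S}"
    using action_bounds(7,8)[OF a, of l] cost_bounds(3,4)[OF g that] that unfolding z_diff_def by auto
  show "max (bhat S k a (event S t)) (ahat S k a (event S t)) \<le> q_diff S k" if "k \<in> {1..numK S}"
    using action_bounds(2,4)[OF a that] unfolding q_diff_def by auto
  show "\<bar>ahat S k a (event S t) - bhat S k a (event S t)\<bar>
      \<le> max (bhat S k a (event S t)) (ahat S k a (event S t))" if "k \<in> {1..numK S}"
    using action_bounds(1,3)[OF a that] by auto
  show "\<bar>g m - xhat S m a (event S t)\<bar> \<le> h_diff S m" if "m \<in> {1..numM S}"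
  proof -
    have "g m \<in> {x_min S m..x_max S m}" using g that unfolding box_set_def by (rule PiE_mem)
    then show ?thesis using action_bounds(5,6)[OF a that] unfolding h_diff_def by auto
  qed
qed

lemma exists_valid_B: "\<exists>B. valid_B S B"
proof
  show "valid_B S (1/2 * (\<Sum>l\<in>{1..numL S}. (z_diff S l)\<^sup>2)
      + 1/2 * (\<Sum>k\<in>{1..numK S}. (b_max S k)\<^sup>2 + (a_max S k)\<^sup>2)
      + 1/2 * (\<Sum>m\<in>{1..numM S}. (h_diff S m)\<^sup>2))"
    unfolding valid_B_def Let_def
  proof (intro allI ballI, clarify)
    fix t a g assume ag: "(a, g) \<in> feasible_pairs S t"
    then have a: "a \<in> action_set S (event S t)" unfolding feasible_pairs_def by auto
    show "1/2 * (\<Sum>l\<in>{1..numL S}. (yhat S l a (event S t) + costg S l g)\<^sup>2)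
      + 1/2 * (\<Sum>k\<in>{1..numK S}. (bhat S k a (event S t))\<^sup>2 + (ahat S k a (event S t))\<^sup>2)
      + 1/2 * (\<Sum>m\<in>{1..numM S}. (g m - xhat S m a (event S t))\<^sup>2)
      \<le> 1/2 * (\<Sum>l\<in>{1..numL S}. (z_diff S l)\<^sup>2)
      + 1/2 * (\<Sum>k\<in>{1..numK S}. (b_max S k)\<^sup>2 + (a_max S k)\<^sup>2)
      + 1/2 * (\<Sum>m\<in>{1..numM S}. (h_diff S m)\<^sup>2)"
      \<comment> \<open>The squares for \<open>Z\<close> and \<open>H\<close> are compared through
        absolute values, so each of these bounds is first weakened to the absolute value of its
        right-hand side.\<close>
      by (intro add_mono mult_left_mono sum_mono power_mono abs_le_square_iff[THEN iffD1]
          order_trans[OF change_bounds(1)[OF ag] abs_ge_self]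
          order_trans[OF change_bounds(4)[OF ag] abs_ge_self] action_bounds[OF a])
        simp_all
  qed
qed

lemma exists_valid_D: "\<exists>D. valid_D S D"
proof
  show "valid_D S (1/2 * (\<Sum>l\<in>{1..numL S}. z_diff S l * z_diff S l)
      + 1/2 * (\<Sum>m\<in>{1..numM S}. h_diff S m * h_diff S m)
      + 1/2 * (\<Sum>k\<in>{1..numK S}. q_diff S k * q_diff S k))"
    unfolding valid_D_def Let_def
  proof (intro allI ballI, clarify)
    fix t a g assume ag: "(a, g) \<in> feasible_pairs S t"
    then have a: "a \<in> action_set S (event S t)" unfolding feasible_pairs_def by auto
    \<comment> \<open>The sign of \<open>q_diff\<close> comes from the existence of an action:
      \<open>a_max\<close> bounds a nonnegative value.\<close>
    have q: "0 \<le> q_diff S k" if "k \<in> {1..numK S}" for k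
      using action_bounds(1,2)[OF a that] unfolding q_diff_def by auto
    show "1/2 * (\<Sum>l\<in>{1..numL S}. z_diff S l * \<bar>yhat S l a (event S t) + costg S l g\<bar>)
      + 1/2 * (\<Sum>m\<in>{1..numM S}. h_diff S m * \<bar>xhat S m a (event S t) - g m\<bar>)
      + 1/2 * (\<Sum>k\<in>{1..numK S}. q_diff S k * max (bhat S k a (event S t)) (ahat S k a (event S t)))
      \<le> 1/2 * (\<Sum>l\<in>{1..numL S}. z_diff S l * z_diff S l)
      + 1/2 * (\<Sum>m\<in>{1..numM S}. h_diff S m * h_diff S m)
      + 1/2 * (\<Sum>k\<in>{1..numK S}. q_diff S k * q_diff S k)"
      using change_bounds[OF ag] q
      by (intro add_mono mult_left_mono sum_mono)
        (auto simp: abs_minus_commute z_diff_def h_diff_def)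
  qed
qed

text \<open>An infimum of reals is known to be a lower bound only for a set that is bounded below.
  With the queues fixed, each queue term is at least minus the absolute queue value times its
  maximum one-slot change.\<close>

lemma decision_cost_bdd_below:
  "bdd_below ((\<lambda>(a, g). decision_cost S V t \<theta> a g) ` feasible_pairs S t)"
proof (rule bdd_belowI2)
  fix p assume p: "p \<in> feasible_pairs S t"
  obtain a g where pag: "p = (a, g)" by (cases p)
  have ag: "(a, g) \<in> feasible_pairs S t" using p pag by simp
  then have a: "a \<in> action_set S (event S t)" and g: "g \<in> box_set S"
    unfolding feasible_pairs_def by auto
  have "V * y_min S 0 + V * f_min S + (\<Sum>l\<in>{1..numL S}. - (\<bar>Zq \<theta> l\<bar> * z_diff S l))
      + (\<Sum>k\<in>{1..numK S}. - (\<bar>Qq \<theta> k\<bar> * q_diff S k))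
      + (\<Sum>m\<in>{1..numM S}. - (\<bar>Hq \<theta> m\<bar> * h_diff S m))
    \<le> decision_cost S V t \<theta> a g"
    unfolding decision_cost_def Let_def
    using action_bounds(7)[OF a, of 0] cost_bounds(1)[OF g] V
    by (intro add_mono sum_mono mult_ge_neg_abs_mult mult_left_mono change_bounds[OF ag]
        order_trans[OF change_bounds(3)[OF ag] change_bounds(2)[OF ag]]) auto
  then show "V * y_min S 0 + V * f_min S + (\<Sum>l\<in>{1..numL S}. - (\<bar>Zq \<theta> l\<bar> * z_diff S l))
      + (\<Sum>k\<in>{1..numK S}. - (\<bar>Qq \<theta> k\<bar> * q_diff S k))
      + (\<Sum>m\<in>{1..numM S}. - (\<bar>Hq \<theta> m\<bar> * h_diff S m))
    \<le> (case p of (a, g) \<Rightarrow> decision_cost S V t \<theta> a g)"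
    unfolding pag by simp
qed

text \<open>The form in which approximate minimality is used: the infimum is gone and the comparison
  is with one feasible competitor at a time.\<close>

lemma decision_cost_le:
  assumes "(a, g) \<in> feasible_pairs S t"
  shows "decision_cost S V t (\<Theta> t) (\<alpha> t) (\<gamma> t) \<le> decision_cost S V t (\<Theta> t) a g + C"
proof -
  have "(INF (a, g)\<in>feasible_pairs S t. decision_cost S V t (\<Theta> t) a g) \<le> decision_cost S V t (\<Theta> t) a g"
    using cINF_lower[OF decision_cost_bdd_below assms] by simp
  then show ?thesis using approx unfolding C_approximate_def by (meson add_right_mono order_trans)
qed

section \<open>Queue updates and the one-slot drift\<close>

lemma Q_step: "k \<in> {1..numK S} \<Longrightarrow> Qq (\<Theta> (Suc t)) k =
    max (Qq (\<Theta> t) k - bhat S k (\<alpha> t) (event S t)) 0 + ahat S k (\<alpha> t) (event S t)"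
  and Z_step: "l \<in> {1..numL S} \<Longrightarrow> Zq (\<Theta> (Suc t)) l =
    max (Zq (\<Theta> t) l + yhat S l (\<alpha> t) (event S t) + costg S l (\<gamma> t)) 0"
  and H_step: "m \<in> {1..numM S} \<Longrightarrow> Hq (\<Theta> (Suc t)) m =
    Hq (\<Theta> t) m + \<gamma> t m - xhat S m (\<alpha> t) (event S t)"
  using dyn unfolding queue_dynamics_def Suc_eq_plus1 by blast+

lemma action: "\<alpha> t \<in> action_set S (event S t)"
  and \<gamma>_Xset: "\<gamma> t \<in> Xset S"
  and \<gamma>_box: "\<gamma> t \<in> box_set S"
  using feasible[of t] unfolding feasible_pairs_def by auto

lemma Z_nonneg: "l \<in> {1..numL S} \<Longrightarrow> 0 \<le> Zq (\<Theta> t) l"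
  using dyn by (cases t) (auto simp: queue_dynamics_def Z_step)

lemma Q_nonneg: "k \<in> {1..numK S} \<Longrightarrow> 0 \<le> Qq (\<Theta> t) k"
  using dyn action_bounds(1)[OF action, of k]
  by (cases t) (auto simp: queue_dynamics_def Q_step simp del: atLeastAtMost_iff intro!: add_nonneg_nonneg)

text \<open>Truncation at 0 does not increase a square, so squaring the updates leaves the old
  squares, the squares of the one-slot quantities and the cross terms. After halving,
  \<open>B\<close> absorbs the second group, and the third is
  \<open>decision_cost S 0\<close>.\<close>

lemma lyapunov_drift:
  assumes "valid_B S B"
  shows "lyapunov S (\<Theta> (Suc t)) \<le> lyapunov S (\<Theta> t) + B + decision_cost S 0 t (\<Theta> t) (\<alpha> t) (\<gamma> t)"
proof -
  let ?w = "event S t"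
  have Z: "(\<Sum>l\<in>{1..numL S}. (Zq (\<Theta> (Suc t)) l)\<^sup>2) \<le> (\<Sum>l\<in>{1..numL S}. (Zq (\<Theta> t) l)\<^sup>2
      + (yhat S l (\<alpha> t) ?w + costg S l (\<gamma> t))\<^sup>2
      + 2 * (Zq (\<Theta> t) l * (yhat S l (\<alpha> t) ?w + costg S l (\<gamma> t))))"
  proof (rule sum_mono)
    fix l assume l: "l \<in> {1..numL S}"
    have "(max (Zq (\<Theta> t) l + yhat S l (\<alpha> t) ?w + costg S l (\<gamma> t)) 0)\<^sup>2
        \<le> (Zq (\<Theta> t) l + (yhat S l (\<alpha> t) ?w + costg S l (\<gamma> t)))\<^sup>2"
      by (auto simp: max_def add.assoc)
    also have "\<dots> = (Zq (\<Theta> t) l)\<^sup>2 + (yhat S l (\<alpha> t) ?w + costg S l (\<gamma> t))\<^sup>2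
      + 2 * (Zq (\<Theta> t) l * (yhat S l (\<alpha> t) ?w + costg S l (\<gamma> t)))"
      by (simp add: power2_sum)
    finally show "(Zq (\<Theta> (Suc t)) l)\<^sup>2 \<le> (Zq (\<Theta> t) l)\<^sup>2
      + (yhat S l (\<alpha> t) ?w + costg S l (\<gamma> t))\<^sup>2
      + 2 * (Zq (\<Theta> t) l * (yhat S l (\<alpha> t) ?w + costg S l (\<gamma> t)))"
      unfolding Z_step[OF l] .
  qed
  have Q: "(\<Sum>k\<in>{1..numK S}. (Qq (\<Theta> (Suc t)) k)\<^sup>2) \<le> (\<Sum>k\<in>{1..numK S}. (Qq (\<Theta> t) k)\<^sup>2
      + (bhat S k (\<alpha> t) ?w)\<^sup>2 + (ahat S k (\<alpha> t) ?w)\<^sup>2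
      + 2 * (Qq (\<Theta> t) k * (ahat S k (\<alpha> t) ?w - bhat S k (\<alpha> t) ?w)))"
    by (rule sum_mono)
      (unfold Q_step, intro queue_square_drift Q_nonneg action_bounds(1,3)[OF action])
  have H: "(\<Sum>m\<in>{1..numM S}. (Hq (\<Theta> (Suc t)) m)\<^sup>2) = (\<Sum>m\<in>{1..numM S}. (Hq (\<Theta> t) m)\<^sup>2
      + (\<gamma> t m - xhat S m (\<alpha> t) ?w)\<^sup>2 + 2 * (Hq (\<Theta> t) m * (\<gamma> t m - xhat S m (\<alpha> t) ?w)))"
    by (rule sum.cong[OF refl]) (unfold H_step, simp add: power2_eq_square algebra_simps)
  have "1/2 * (\<Sum>l\<in>{1..numL S}. (yhat S l (\<alpha> t) ?w + costg S l (\<gamma> t))\<^sup>2)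
      + 1/2 * (\<Sum>k\<in>{1..numK S}. (bhat S k (\<alpha> t) ?w)\<^sup>2 + (ahat S k (\<alpha> t) ?w)\<^sup>2)
      + 1/2 * (\<Sum>m\<in>{1..numM S}. (\<gamma> t m - xhat S m (\<alpha> t) ?w)\<^sup>2) \<le> B"
    using assms feasible[of t] unfolding valid_B_def Let_def by blast
  then show ?thesis
    using Z Q H unfolding lyapunov_def decision_cost_def Let_def sum.distrib sum_distrib_left[symmetric]
    by argo
qed

text \<open>Adding the penalty to both sides of the drift bound completes the queue terms to the
  expression that the algorithm approximately minimises; any feasible pair may then replace the
  chosen one at the price of \<open>C\<close>.\<close>

lemma drift_plus_penalty:
  assumes B: "valid_B S B" and ag: "(a, g) \<in> feasible_pairs S t"
  shows "lyapunov S (\<Theta> (Suc t)) - lyapunov S (\<Theta> t)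
      + V * (yhat S 0 (\<alpha> t) (event S t) + costf S (\<gamma> t))
    \<le> B + C + V * (yhat S 0 a (event S t) + costf S g) + decision_cost S 0 t (\<Theta> t) a g"
  using lyapunov_drift[OF B, of t] decision_cost_le[OF ag]
  unfolding decision_cost_split[of S V] by (simp add: algebra_simps)

end

context approximate_run
begin

section \<open>Queue bounds\<close>

lemma safe_action:
  obtains a where "a \<in> action_set S (event S t)" and "xvec S a (event S t) \<in> Xset S"
    and "\<And>l. l \<in> {1..numL S} \<Longrightarrow> yhat S l a (event S t) + costg S l (xvec S a (event S t)) \<le> 0"
    and "\<And>k. k \<in> {1..numK S} \<Longrightarrow> ahat S k a (event S t) \<le> bhat S k a (event S t)"
  using bspec[OF A2[unfolded assumption_A2_def] rangeI[of "event S" t]] that by blast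

text \<open>The constant \<open>C\<^sub>0\<^sup>2 / 2\<close>.\<close>

definition drift_bound :: "real \<Rightarrow> real" where
  "drift_bound B = (B + C) / V + (y_max S 0 - y_min S 0) + (f_max S - f_min S)"

text \<open>The competitor is an action from A2 with its own \<open>xvec\<close> as auxiliary
  vector. The \<open>H\<close> terms then vanish whatever the sign of \<open>H\<close>, and the
  other queue terms are nonpositive. What remains is the gap between two penalties, bounded by the
  ranges of \<open>yhat S 0\<close> and \<open>costf S\<close>.\<close>

lemma lyapunov_Suc_le:
  assumes B: "valid_B S B"
  shows "lyapunov S (\<Theta> (Suc t)) \<le> lyapunov S (\<Theta> t) + V * drift_bound B"
proof -
  let ?w = "event S t"
  obtain a where a: "a \<in> action_set S ?w" "xvec S a ?w \<in> Xset S"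
    and g: "\<And>l. l \<in> {1..numL S} \<Longrightarrow> yhat S l a ?w + costg S l (xvec S a ?w) \<le> 0"
    and ab: "\<And>k. k \<in> {1..numK S} \<Longrightarrow> ahat S k a ?w \<le> bhat S k a ?w"
    by (rule safe_action[of t]) blast
  have box: "xvec S a ?w \<in> box_set S" using a(1) by (rule xvec_box)
  have feas: "(a, xvec S a ?w) \<in> feasible_pairs S t" using a box unfolding feasible_pairs_def by simp
  have "(\<Sum>l\<in>{1..numL S}. Zq (\<Theta> t) l * (yhat S l a ?w + costg S l (xvec S a ?w))) \<le> 0"
    by (intro sum_nonpos mult_nonneg_nonpos Z_nonneg g)
  moreover have "(\<Sum>k\<in>{1..numK S}. Qq (\<Theta> t) k * (ahat S k a ?w - bhat S k a ?w)) \<le> 0"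
    by (intro sum_nonpos mult_nonneg_nonpos Q_nonneg) (simp_all add: ab)
  moreover have "(\<Sum>m\<in>{1..numM S}. Hq (\<Theta> t) m * (xvec S a ?w m - xhat S m a ?w)) = 0"
    by (intro sum.neutral) (simp add: xvec_def)
  ultimately have "decision_cost S 0 t (\<Theta> t) a (xvec S a ?w) \<le> 0"
    unfolding decision_cost_def Let_def by linarith
  then have "lyapunov S (\<Theta> (Suc t)) - lyapunov S (\<Theta> t)
      + V * (yhat S 0 (\<alpha> t) ?w + costf S (\<gamma> t))
      \<le> B + C + V * (yhat S 0 a ?w + costf S (xvec S a ?w))"
    using drift_plus_penalty[OF B feas] by linarith
  also have "\<dots> \<le> B + C + V * (y_max S 0 + f_max S)"
    using action_bounds(8)[OF a(1), of 0] cost_bounds(2)[OF box] V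
    by (intro add_left_mono mult_left_mono) auto
  finally have "lyapunov S (\<Theta> (Suc t)) - lyapunov S (\<Theta> t)
      + V * (yhat S 0 (\<alpha> t) ?w + costf S (\<gamma> t)) \<le> B + C + V * (y_max S 0 + f_max S)" .
  moreover have "V * (y_min S 0 + f_min S) \<le> V * (yhat S 0 (\<alpha> t) ?w + costf S (\<gamma> t))"
    using action_bounds(7)[OF action, of 0] cost_bounds(1)[OF \<gamma>_box] V
    by (intro mult_left_mono add_mono) auto
  moreover have "V * drift_bound B = B + C + V * (y_max S 0 + f_max S) - V * (y_min S 0 + f_min S)"
    using V by (simp add: drift_bound_def field_simps)
  ultimately show ?thesis by linarith
qed

lemma lyapunov_le: "valid_B S B \<Longrightarrow> lyapunov S (\<Theta> t) \<le> lyapunov S (\<Theta> 0) + real t * (V * drift_bound B)"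
proof (induction t)
  case (Suc t)
  then show ?case using lyapunov_Suc_le[OF Suc.prems, of t] by (simp add: algebra_simps)
qed simp

text \<open>\<open>C0\<close> is the square root of twice this constant, and squaring
  \<open>C0\<close> gives that back only for a nonnegative radicand. \<open>B\<close> bounds a sum
  of squares on slot 0, where the run supplies a feasible decision.\<close>

lemma drift_bound_nonneg:
  assumes "valid_B S B"
  shows "0 \<le> drift_bound B"
proof -
  have "1/2 * (\<Sum>l\<in>{1..numL S}. (yhat S l (\<alpha> 0) (event S 0) + costg S l (\<gamma> 0))\<^sup>2)
      + 1/2 * (\<Sum>k\<in>{1..numK S}. (bhat S k (\<alpha> 0) (event S 0))\<^sup>2 + (ahat S k (\<alpha> 0) (event S 0))\<^sup>2)
      + 1/2 * (\<Sum>m\<in>{1..numM S}. (\<gamma> 0 m - xhat S m (\<alpha> 0) (event S 0))\<^sup>2) \<le> B"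
    using assms feasible[of 0] unfolding valid_B_def Let_def by blast
  moreover have "0 \<le> 1/2 * (\<Sum>l\<in>{1..numL S}. (yhat S l (\<alpha> 0) (event S 0) + costg S l (\<gamma> 0))\<^sup>2)
      + 1/2 * (\<Sum>k\<in>{1..numK S}. (bhat S k (\<alpha> 0) (event S 0))\<^sup>2 + (ahat S k (\<alpha> 0) (event S 0))\<^sup>2)
      + 1/2 * (\<Sum>m\<in>{1..numM S}. (\<gamma> 0 m - xhat S m (\<alpha> 0) (event S 0))\<^sup>2)"
    by (intro add_nonneg_nonneg mult_nonneg_nonneg sum_nonneg) auto
  ultimately have "0 \<le> B" by linarith
  moreover have "y_min S 0 \<le> y_max S 0"
    using action_bounds(7,8)[OF action[of 0], of 0] by auto
  moreover have "f_min S \<le> f_max S" using cost_bounds(1,2)[OF \<gamma>_box[of 0]] by linarith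
  ultimately show ?thesis using C V unfolding drift_bound_def by auto
qed

lemma sum_squares_queues_le:
  assumes B: "valid_B S B" and C0: "C0 = sqrt (2 * drift_bound B)"
  shows "(\<Sum>l\<in>{1..numL S}. (Zq (\<Theta> t) l)\<^sup>2) + (\<Sum>k\<in>{1..numK S}. (Qq (\<Theta> t) k)\<^sup>2)
    + (\<Sum>m\<in>{1..numM S}. (Hq (\<Theta> t) m)\<^sup>2) \<le> real t * V * C0\<^sup>2 + 2 * lyapunov S (\<Theta> 0)"
proof -
  have "C0\<^sup>2 = 2 * drift_bound B" using drift_bound_nonneg[OF B] C0 by simp
  then show ?thesis using lyapunov_le[OF B, of t] unfolding lyapunov_def[of S "\<Theta> t"] by simp
qed

lemma abs_queues_le:
  assumes B: "valid_B S B" and C0: "C0 = sqrt (2 * drift_bound B)"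
  defines "U \<equiv> \<lambda>t. sqrt (real t * V * C0\<^sup>2 + 2 * lyapunov S (\<Theta> 0))"
  shows "l \<in> {1..numL S} \<Longrightarrow> \<bar>Zq (\<Theta> t) l\<bar> \<le> U t"
    and "k \<in> {1..numK S} \<Longrightarrow> \<bar>Qq (\<Theta> t) k\<bar> \<le> U t"
    and "m \<in> {1..numM S} \<Longrightarrow> \<bar>Hq (\<Theta> t) m\<bar> \<le> U t"
proof -
  note * = sum_squares_queues_le[OF B C0, of t]
  have nonneg: "0 \<le> (\<Sum>l\<in>{1..numL S}. (Zq (\<Theta> t) l)\<^sup>2)" "0 \<le> (\<Sum>k\<in>{1..numK S}. (Qq (\<Theta> t) k)\<^sup>2)"
    "0 \<le> (\<Sum>m\<in>{1..numM S}. (Hq (\<Theta> t) m)\<^sup>2)" by (intro sum_nonneg; simp)+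
  show "\<bar>Zq (\<Theta> t) l\<bar> \<le> U t" if "l \<in> {1..numL S}"
    using * nonneg member_le_sum[OF that, of "\<lambda>l. (Zq (\<Theta> t) l)\<^sup>2"] unfolding U_def
    by (intro real_le_rsqrt) simp
  show "\<bar>Qq (\<Theta> t) k\<bar> \<le> U t" if "k \<in> {1..numK S}"
    using * nonneg member_le_sum[OF that, of "\<lambda>k. (Qq (\<Theta> t) k)\<^sup>2"] unfolding U_def
    by (intro real_le_rsqrt) simp
  show "\<bar>Hq (\<Theta> t) m\<bar> \<le> U t" if "m \<in> {1..numM S}"
    using * nonneg member_le_sum[OF that, of "\<lambda>m. (Hq (\<Theta> t) m)\<^sup>2"] unfolding U_def
    by (intro real_le_rsqrt) simp
qed

lemma empty_queue_bound:
  assumes "valid_B S B" "C0 = sqrt (2 * drift_bound B)" "all_queues_empty S (\<Theta> 0)"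
  shows "sqrt (real t * V * C0\<^sup>2 + 2 * lyapunov S (\<Theta> 0)) = C0 * sqrt (real t * V)"
proof -
  have "lyapunov S (\<Theta> 0) = 0" using assms(3) unfolding lyapunov_def all_queues_empty_def by simp
  \<comment> \<open>The root of \<open>C0\<^sup>2\<close> is the absolute value of
    \<open>C0\<close>, so the sign is needed.\<close>
  moreover have "0 \<le> C0" using drift_bound_nonneg[OF assms(1)] assms(2) by simp
  ultimately show ?thesis by (simp add: real_sqrt_mult)
qed

section \<open>Time averages\<close>

text \<open>Dropping the maximum in the update bounds the increment of the queue from below, and the
  increments telescope. The same holds for \<open>Q\<close>; the update of \<open>H\<close> has no
  maximum and gives equality.\<close>

lemma sum_le_Z: "l \<in> {1..numL S} \<Longrightarrow>
    (\<Sum>\<tau><n. yhat S l (\<alpha> \<tau>) (event S \<tau>) + costg S l (\<gamma> \<tau>)) \<le> Zq (\<Theta> n) l - Zq (\<Theta> 0) l"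
  by (induction n) (auto simp: Z_step simp del: atLeastAtMost_iff)

lemma sum_le_Q: "k \<in> {1..numK S} \<Longrightarrow>
    (\<Sum>\<tau><n. ahat S k (\<alpha> \<tau>) (event S \<tau>) - bhat S k (\<alpha> \<tau>) (event S \<tau>)) \<le> Qq (\<Theta> n) k - Qq (\<Theta> 0) k"
  by (induction n) (auto simp: Q_step simp del: atLeastAtMost_iff)

lemma sum_eq_H: "m \<in> {1..numM S} \<Longrightarrow>
    (\<Sum>\<tau><n. \<gamma> \<tau> m - xhat S m (\<alpha> \<tau>) (event S \<tau>)) = Hq (\<Theta> n) m - Hq (\<Theta> 0) m"
  by (induction n) (auto simp: H_step simp del: atLeastAtMost_iff)

definition \<gamma>bar :: "nat \<Rightarrow> nat \<Rightarrow> real" where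
  "\<gamma>bar n = (\<lambda>m\<in>{1..numM S}. time_avg n (\<lambda>\<tau>. \<gamma> \<tau> m))"

lemma \<gamma>bar_Xset: "n > 0 \<Longrightarrow> \<gamma>bar n \<in> Xset S"
  using vec_convex_mean[OF Xset_convex Xset_extensional, of "{..<n}" \<gamma>] \<gamma>_Xset
  unfolding \<gamma>bar_def time_avg_def by auto

text \<open>The queue \<open>H\<close> records how far the auxiliary vectors have moved away from
  \<open>x\<close> on average. This gap enters the Lipschitz bounds and is the vector \<epsilon> of
  claim (b).\<close>

lemma \<gamma>bar_minus_xbar:
  "m \<in> {1..numM S} \<Longrightarrow> \<gamma>bar n m - xbar S \<alpha> n m = (Hq (\<Theta> n) m - Hq (\<Theta> 0) m) / real n"
  unfolding sum_eq_H[symmetric] by (simp add: \<gamma>bar_def xbar_def time_avg_def sum_subtractf diff_divide_distrib)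

lemma xbar_box: "n > 0 \<Longrightarrow> xbar S \<alpha> n \<in> box_set S"
proof -
  assume n: "n > 0"
  have "vec_convex (numM S) (box_set S)" using costf_convex unfolding vec_convex_on_def by blast
  from vec_convex_mean[OF this box_extensional, of "{..<n}" "\<lambda>\<tau>. xvec S (\<alpha> \<tau>) (event S \<tau>)"]
  have "(\<lambda>m\<in>{1..numM S}. 1 / real n * (\<Sum>\<tau><n. xvec S (\<alpha> \<tau>) (event S \<tau>) m)) \<in> box_set S"
    using n xvec_box[OF action] by auto
  also have "(\<lambda>m\<in>{1..numM S}. 1 / real n * (\<Sum>\<tau><n. xvec S (\<alpha> \<tau>) (event S \<tau>) m)) = xbar S \<alpha> n"
    unfolding xbar_def time_avg_def by (rule restrict_ext) (simp add: xvec_def)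
  finally show ?thesis .
qed

text \<open>The Lipschitz bound moves from \<open>xbar\<close> to \<open>\<gamma>bar\<close>, with
  the coordinate differences read off from \<open>H\<close>; Jensen's inequality then bounds the
  cost at \<open>\<gamma>bar\<close>. It serves both \<open>costf\<close> and each
  \<open>costg\<close>.\<close>

lemma cost_xbar_le:
  assumes \<phi>: "regular_cost S \<phi> c" and n: "n > 0"
  shows "\<phi> (xbar S \<alpha> n) \<le> time_avg n (\<lambda>\<tau>. \<phi> (\<gamma> \<tau>))
    + (\<Sum>m\<in>{1..numM S}. c m * \<bar>Hq (\<Theta> n) m - Hq (\<Theta> 0) m\<bar> / real n)"
proof -
  have "vec_convex_on (numM S) (box_set S) \<phi>" using \<phi> unfolding regular_cost_def by blast
  from vec_convex_on_mean[OF this box_extensional, of "{..<n}" \<gamma>]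
  have \<gamma>: "\<gamma>bar n \<in> box_set S" "\<phi> (\<gamma>bar n) \<le> time_avg n (\<lambda>\<tau>. \<phi> (\<gamma> \<tau>))"
    using n \<gamma>_box unfolding \<gamma>bar_def time_avg_def by auto
  have "\<phi> (xbar S \<alpha> n) \<le> \<phi> (\<gamma>bar n) + (\<Sum>m\<in>{1..numM S}. c m * \<bar>xbar S \<alpha> n m - \<gamma>bar n m\<bar>)"
    by (rule regular_cost_lipschitz[OF \<phi> \<gamma>(1) xbar_box[OF n]])
  also have "(\<Sum>m\<in>{1..numM S}. c m * \<bar>xbar S \<alpha> n m - \<gamma>bar n m\<bar>)
      = (\<Sum>m\<in>{1..numM S}. c m * \<bar>Hq (\<Theta> n) m - Hq (\<Theta> 0) m\<bar> / real n)"
    by (rule sum.cong[OF refl]) (subst abs_minus_commute, simp only: \<gamma>bar_minus_xbar abs_divide, simp)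
  finally show ?thesis using \<gamma>(2) by linarith
qed

lemma empty_queues_div_le:
  assumes B: "valid_B S B" "C0 = sqrt (2 * drift_bound B)" and empty: "all_queues_empty S (\<Theta> 0)"
    and n: "n > 0"
  shows "l \<in> {1..numL S} \<Longrightarrow> (Zq (\<Theta> n) l - Zq (\<Theta> 0) l) / real n \<le> C0 * sqrt (V / real n)"
    and "k \<in> {1..numK S} \<Longrightarrow> (Qq (\<Theta> n) k - Qq (\<Theta> 0) k) / real n \<le> C0 * sqrt (V / real n)"
    and "m \<in> {1..numM S} \<Longrightarrow> \<bar>Hq (\<Theta> n) m - Hq (\<Theta> 0) m\<bar> / real n \<le> C0 * sqrt (V / real n)"
proof -
  \<comment> \<open>The queue bound grows like the root of \<open>n\<close>, so division by
    \<open>n\<close> leaves a decay like one over that root.\<close>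
  have "sqrt (V / real n) = sqrt (real n * V / (real n)\<^sup>2)" using n by (simp add: power2_eq_square)
  also have "\<dots> = sqrt (real n * V) / real n" by (simp only: real_sqrt_divide real_sqrt_abs abs_of_nat)
  finally have *: "C0 * sqrt (V / real n) = C0 * sqrt (real n * V) / real n" by simp
  note bounds = abs_queues_le[OF B, of _ n, unfolded empty_queue_bound[OF B empty]]
  show "(Zq (\<Theta> n) l - Zq (\<Theta> 0) l) / real n \<le> C0 * sqrt (V / real n)" if "l \<in> {1..numL S}"
    using bounds(1)[OF that] empty that unfolding * all_queues_empty_def
    by (intro divide_right_mono) auto
  show "(Qq (\<Theta> n) k - Qq (\<Theta> 0) k) / real n \<le> C0 * sqrt (V / real n)" if "k \<in> {1..numK S}"
    using bounds(2)[OF that] empty that unfolding * all_queues_empty_def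
    by (intro divide_right_mono) auto
  show "\<bar>Hq (\<Theta> n) m - Hq (\<Theta> 0) m\<bar> / real n \<le> C0 * sqrt (V / real n)" if "m \<in> {1..numM S}"
    using bounds(3)[OF that] empty that unfolding * all_queues_empty_def
    by (intro divide_right_mono) auto
qed

lemma time_average_constraints:
  assumes B: "valid_B S B" "C0 = sqrt (2 * drift_bound B)" and empty: "all_queues_empty S (\<Theta> 0)"
    and n: "n > 0"
  shows "l \<in> {1..numL S} \<Longrightarrow> ybar S \<alpha> n l + costg S l (xbar S \<alpha> n)
      \<le> C0 * sqrt (V / real n) * (1 + (\<Sum>m\<in>{1..numM S}. beta S l m))"
    and "k \<in> {1..numK S} \<Longrightarrow> abar S \<alpha> n k \<le> bbar S \<alpha> n k + C0 * sqrt (V / real n)"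
    and "\<exists>\<epsilon>::nat \<Rightarrow> real. (\<forall>m\<in>{1..numM S}. \<bar>\<epsilon> m\<bar> \<le> C0 * sqrt (V / real n)) \<and>
      (\<lambda>m\<in>{1..numM S}. xbar S \<alpha> n m + \<epsilon> m) \<in> Xset S"
proof -
  note bounds = empty_queues_div_le[OF B empty n]
  show "ybar S \<alpha> n l + costg S l (xbar S \<alpha> n)
      \<le> C0 * sqrt (V / real n) * (1 + (\<Sum>m\<in>{1..numM S}. beta S l m))" if l: "l \<in> {1..numL S}"
  proof -
    have reg: "regular_cost S (costg S l) (beta S l)" using costs l unfolding cost_assumptions_def by blast
    have "ybar S \<alpha> n l + time_avg n (\<lambda>\<tau>. costg S l (\<gamma> \<tau>))
        = (\<Sum>\<tau><n. yhat S l (\<alpha> \<tau>) (event S \<tau>) + costg S l (\<gamma> \<tau>)) / real n"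
      by (simp add: ybar_def time_avg_def sum.distrib add_divide_distrib)
    also have "\<dots> \<le> (Zq (\<Theta> n) l - Zq (\<Theta> 0) l) / real n"
      by (intro divide_right_mono sum_le_Z l) simp
    also have "\<dots> \<le> C0 * sqrt (V / real n)" by (rule bounds(1)[OF l])
    finally have "ybar S \<alpha> n l + time_avg n (\<lambda>\<tau>. costg S l (\<gamma> \<tau>)) \<le> C0 * sqrt (V / real n)" .
    moreover have "(\<Sum>m\<in>{1..numM S}. beta S l m * \<bar>Hq (\<Theta> n) m - Hq (\<Theta> 0) m\<bar> / real n)
        \<le> (\<Sum>m\<in>{1..numM S}. beta S l m * (C0 * sqrt (V / real n)))"
      unfolding times_divide_eq_right[symmetric]
      using reg by (intro sum_mono mult_left_mono bounds(3)) (auto simp: regular_cost_def)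
    moreover have "\<dots> = C0 * sqrt (V / real n) * (\<Sum>m\<in>{1..numM S}. beta S l m)"
      by (simp only: sum_distrib_right[symmetric] mult.commute)
    ultimately show ?thesis using cost_xbar_le[OF reg n] by (simp only: distrib_left mult_1_right)
  qed
  show "abar S \<alpha> n k \<le> bbar S \<alpha> n k + C0 * sqrt (V / real n)" if k: "k \<in> {1..numK S}"
  proof -
    have "abar S \<alpha> n k - bbar S \<alpha> n k
        = (\<Sum>\<tau><n. ahat S k (\<alpha> \<tau>) (event S \<tau>) - bhat S k (\<alpha> \<tau>) (event S \<tau>)) / real n"
      by (simp add: abar_def bbar_def time_avg_def sum_subtractf diff_divide_distrib)
    also have "\<dots> \<le> (Qq (\<Theta> n) k - Qq (\<Theta> 0) k) / real n"
      by (intro divide_right_mono sum_le_Q k) simp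
    also have "\<dots> \<le> C0 * sqrt (V / real n)" by (rule bounds(2)[OF k])
    finally show ?thesis by simp
  qed
  show "\<exists>\<epsilon>::nat \<Rightarrow> real. (\<forall>m\<in>{1..numM S}. \<bar>\<epsilon> m\<bar> \<le> C0 * sqrt (V / real n)) \<and>
      (\<lambda>m\<in>{1..numM S}. xbar S \<alpha> n m + \<epsilon> m) \<in> Xset S"
  \<comment> \<open>This witness turns the shifted average into \<open>\<gamma>bar n\<close>, a mean
    of points of the convex set \<open>Xset S\<close>.\<close>
  proof (intro exI[of _ "\<lambda>m. \<gamma>bar n m - xbar S \<alpha> n m"] conjI ballI)
    show "\<bar>\<gamma>bar n m - xbar S \<alpha> n m\<bar> \<le> C0 * sqrt (V / real n)" if "m \<in> {1..numM S}" for m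
      using bounds(3)[OF that] unfolding \<gamma>bar_minus_xbar[OF that] by simp
    have "(\<lambda>m\<in>{1..numM S}. xbar S \<alpha> n m + (\<gamma>bar n m - xbar S \<alpha> n m)) = \<gamma>bar n"
      by (auto simp: \<gamma>bar_def restrict_def)
    then show "(\<lambda>m\<in>{1..numM S}. xbar S \<alpha> n m + (\<gamma>bar n m - xbar S \<alpha> n m)) \<in> Xset S"
      using \<gamma>bar_Xset[OF n] by simp
  qed
qed

end

section \<open>Comparison with \<open>T\<close>-slot lookahead\<close>

text \<open>The total age of queue values frozen at the start of the frame; multiplied by
  \<open>2 * D\<close> it becomes the error \<open>D * T * (T - 1)\<close> of one frame.\<close>

lemma sum_frame_index: "(\<Sum>\<tau>\<in>{r * T..<(r + 1) * T}. real (\<tau> - r * T)) = real T * (real T - 1) / 2"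
proof -
  have "(\<Sum>\<tau>\<in>{r * T..<(r + 1) * T}. real (\<tau> - r * T)) = (\<Sum>j<T. real j)"
    by (rule sum.reindex_bij_witness[of _ "\<lambda>j. j + r * T" "\<lambda>\<tau>. \<tau> - r * T"]) auto
  also have "\<dots> = real T * (real T - 1) / 2"
    by (induction T) (simp_all add: field_simps)
  finally show ?thesis .
qed

text \<open>The price of replacing a current queue value \<open>z'\<close> by an older one
  \<open>z\<close>, written so that \<open>d * v\<close> matches a summand of
  \<open>valid_D\<close>.\<close>

lemma mult_change_le:
  fixes z z' j d u v :: real
  assumes "\<bar>z' - z\<bar> \<le> j * d" and "\<bar>u\<bar> \<le> v"
  shows "z' * u \<le> z * u + j * (d * v)"
proof -
  have "(z' - z) * u \<le> \<bar>z' - z\<bar> * \<bar>u\<bar>" by (metis abs_ge_self abs_mult)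
  also have "\<dots> \<le> (j * d) * v" using assms by (intro mult_mono) auto
  finally show ?thesis by (simp add: algebra_simps)
qed

section \<open>Movement of the queues within a frame\<close>

context approximate_run
begin

text \<open>Since the queue is nonnegative, truncation at 0 can only shorten a step.\<close>

lemma Z_change: "l \<in> {1..numL S} \<Longrightarrow> \<bar>Zq (\<Theta> (s + j)) l - Zq (\<Theta> s) l\<bar> \<le> real j * z_diff S l"
proof (induction j)
  case (Suc j)
  have "\<bar>Zq (\<Theta> (Suc (s + j))) l - Zq (\<Theta> (s + j)) l\<bar> \<le> z_diff S l"
    using change_bounds(1)[OF feasible[of "s + j"] Suc.prems] Z_nonneg[OF Suc.prems, of "s + j"]
    unfolding Z_step[OF Suc.prems] by linarith
  then show ?case using Suc by (simp add: algebra_simps)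
qed simp

text \<open>One update moves the queue down by at most \<open>bhat\<close> and up by at most
  \<open>ahat\<close>, hence by at most their maximum.\<close>

lemma Q_change: "k \<in> {1..numK S} \<Longrightarrow> \<bar>Qq (\<Theta> (s + j)) k - Qq (\<Theta> s) k\<bar> \<le> real j * q_diff S k"
proof (induction j)
  case (Suc j)
  have "\<bar>Qq (\<Theta> (Suc (s + j))) k - Qq (\<Theta> (s + j)) k\<bar> \<le> q_diff S k"
    using change_bounds(2)[OF feasible[of "s + j"] Suc.prems] Q_nonneg[OF Suc.prems, of "s + j"]
      action_bounds(1,3)[OF action[of "s + j"] Suc.prems]
    unfolding Q_step[OF Suc.prems] by linarith
  then show ?case using Suc by (simp add: algebra_simps)
qed simp

lemma H_change: "m \<in> {1..numM S} \<Longrightarrow> \<bar>Hq (\<Theta> (s + j)) m - Hq (\<Theta> s) m\<bar> \<le> real j * h_diff S m"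
proof (induction j)
  case (Suc j)
  have "\<bar>Hq (\<Theta> (Suc (s + j))) m - Hq (\<Theta> (s + j)) m\<bar> \<le> h_diff S m"
    using change_bounds(4)[OF feasible[of "s + j"] Suc.prems]
    unfolding H_step[OF Suc.prems] by linarith
  then show ?case using Suc by (simp add: algebra_simps)
qed simp

text \<open>Only the queues are frozen at slot \<open>s\<close>; the event stays that of slot
  \<open>s + j\<close>. Each queue has moved by at most \<open>j\<close> times its maximum change,
  and the factor 2 undoes the 1/2 in \<open>valid_D\<close>.\<close>

lemma decision_cost_stale_queues:
  assumes D: "valid_D S D" and ag: "(a, g) \<in> feasible_pairs S (s + j)"
  shows "decision_cost S 0 (s + j) (\<Theta> (s + j)) a g
    \<le> decision_cost S 0 (s + j) (\<Theta> s) a g + real j * (2 * D)"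
proof -
  let ?w = "event S (s + j)"
  have Z: "(\<Sum>l\<in>{1..numL S}. Zq (\<Theta> (s + j)) l * (yhat S l a ?w + costg S l g))
      \<le> (\<Sum>l\<in>{1..numL S}. Zq (\<Theta> s) l * (yhat S l a ?w + costg S l g)
          + real j * (z_diff S l * \<bar>yhat S l a ?w + costg S l g\<bar>))"
    by (intro sum_mono mult_change_le Z_change) auto
  have Q: "(\<Sum>k\<in>{1..numK S}. Qq (\<Theta> (s + j)) k * (ahat S k a ?w - bhat S k a ?w))
      \<le> (\<Sum>k\<in>{1..numK S}. Qq (\<Theta> s) k * (ahat S k a ?w - bhat S k a ?w)
          + real j * (q_diff S k * max (bhat S k a ?w) (ahat S k a ?w)))"
    by (intro sum_mono mult_change_le Q_change change_bounds(3)[OF ag])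
  have H: "(\<Sum>m\<in>{1..numM S}. Hq (\<Theta> (s + j)) m * (g m - xhat S m a ?w))
      \<le> (\<Sum>m\<in>{1..numM S}. Hq (\<Theta> s) m * (g m - xhat S m a ?w)
          + real j * (h_diff S m * \<bar>xhat S m a ?w - g m\<bar>))"
    by (intro sum_mono mult_change_le H_change) auto
  have "1/2 * (\<Sum>l\<in>{1..numL S}. z_diff S l * \<bar>yhat S l a ?w + costg S l g\<bar>)
      + 1/2 * (\<Sum>m\<in>{1..numM S}. h_diff S m * \<bar>xhat S m a ?w - g m\<bar>)
      + 1/2 * (\<Sum>k\<in>{1..numK S}. q_diff S k * max (bhat S k a ?w) (ahat S k a ?w)) \<le> D"
    using D ag unfolding valid_D_def Let_def by blast
  then have "(\<Sum>l\<in>{1..numL S}. z_diff S l * \<bar>yhat S l a ?w + costg S l g\<bar>)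
      + (\<Sum>m\<in>{1..numM S}. h_diff S m * \<bar>xhat S m a ?w - g m\<bar>)
      + (\<Sum>k\<in>{1..numK S}. q_diff S k * max (bhat S k a ?w) (ahat S k a ?w)) \<le> 2 * D"
    by argo
  then have "real j * ((\<Sum>l\<in>{1..numL S}. z_diff S l * \<bar>yhat S l a ?w + costg S l g\<bar>)
      + (\<Sum>m\<in>{1..numM S}. h_diff S m * \<bar>xhat S m a ?w - g m\<bar>)
      + (\<Sum>k\<in>{1..numK S}. q_diff S k * max (bhat S k a ?w) (ahat S k a ?w))) \<le> real j * (2 * D)"
    by (rule mult_left_mono) simp
  then show ?thesis
    using Z Q H unfolding decision_cost_def Let_def sum.distrib
      sum_distrib_left[symmetric] distrib_left[of "real j"]
    by argo
qed

section \<open>Feasibility of the lookahead problem\<close>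

lemma frame_x_box_Xset:
  assumes "T > 0" and a: "\<And>\<tau>. \<tau> \<in> {r * T..<(r + 1) * T} \<Longrightarrow> a \<tau> \<in> action_set S (event S \<tau>)"
  shows "frame_x S T r a \<in> box_set S"
    and "(\<And>\<tau>. \<tau> \<in> {r * T..<(r + 1) * T} \<Longrightarrow> xvec S (a \<tau>) (event S \<tau>) \<in> Xset S) \<Longrightarrow> frame_x S T r a \<in> Xset S"
    and "vec_convex_on (numM S) (box_set S) \<phi> \<Longrightarrow>
      \<phi> (frame_x S T r a) \<le> frame_avg T r (\<lambda>\<tau>. \<phi> (xvec S (a \<tau>) (event S \<tau>)))"
proof -
  let ?I = "{r * T..<(r + 1) * T}" and ?p = "\<lambda>\<tau>. xvec S (a \<tau>) (event S \<tau>)"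
  have I: "finite ?I" "?I \<noteq> {}" and card: "card ?I = T" using assms(1) by auto
  have box: "xvec S (a \<tau>) (event S \<tau>) \<in> box_set S" if "\<tau> \<in> ?I" for \<tau>
    using a[OF that] by (rule xvec_box)
  \<comment> \<open>The frame average is an equal-weight mean of the vectors \<open>xvec\<close>, so
    all three claims are instances of the results on means.\<close>
  have eq: "(\<lambda>m\<in>{1..numM S}. 1 / real (card ?I) * (\<Sum>\<tau>\<in>?I. xvec S (a \<tau>) (event S \<tau>) m)) = frame_x S T r a"
    unfolding frame_x_def frame_avg_def card by (rule restrict_ext) (simp add: xvec_def)
  show "frame_x S T r a \<in> box_set S"
    using vec_convex_on_mean[where p = ?p, OF costf_convex box_extensional I box] unfolding eq by blast
  show "frame_x S T r a \<in> Xset S" if "\<And>\<tau>. \<tau> \<in> ?I \<Longrightarrow> xvec S (a \<tau>) (event S \<tau>) \<in> Xset S"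
    using vec_convex_mean[where p = ?p, OF Xset_convex Xset_extensional I that] unfolding eq .
  show "\<phi> (frame_x S T r a) \<le> frame_avg T r (\<lambda>\<tau>. \<phi> (xvec S (a \<tau>) (event S \<tau>)))"
    if "vec_convex_on (numM S) (box_set S) \<phi>"
    using vec_convex_on_mean[where p = ?p, OF that box_extensional I box] unfolding eq unfolding card frame_avg_def by blast
qed

text \<open>This makes the set under the infimum \<open>F_star\<close> nonempty. An action from A2
  is taken on each slot; Jensen's inequality for \<open>costg\<close> passes from the slotwise
  constraints to the averaged ones.\<close>

lemma exists_lookahead_feasible:
  assumes T: "T > 0"
  shows "\<exists>a. lookahead_feasible S T r a"
proof -
  define safe where "safe = (\<lambda>\<tau> a. a \<in> action_set S (event S \<tau>) \<and> xvec S a (event S \<tau>) \<in> Xset S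
    \<and> (\<forall>l\<in>{1..numL S}. yhat S l a (event S \<tau>) + costg S l (xvec S a (event S \<tau>)) \<le> 0)
    \<and> (\<forall>k\<in>{1..numK S}. ahat S k a (event S \<tau>) \<le> bhat S k a (event S \<tau>)))"
  have "\<exists>a. safe \<tau> a" for \<tau> using safe_action[of \<tau>] unfolding safe_def by metis
  then obtain a where a: "\<And>\<tau>. safe \<tau> (a \<tau>)" by metis
  then have act: "\<And>\<tau>. a \<tau> \<in> action_set S (event S \<tau>)" and X: "\<And>\<tau>. xvec S (a \<tau>) (event S \<tau>) \<in> Xset S"
    and g: "\<And>\<tau> l. l \<in> {1..numL S} \<Longrightarrow> yhat S l (a \<tau>) (event S \<tau>) + costg S l (xvec S (a \<tau>) (event S \<tau>)) \<le> 0"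
    and ab: "\<And>\<tau> k. k \<in> {1..numK S} \<Longrightarrow> ahat S k (a \<tau>) (event S \<tau>) \<le> bhat S k (a \<tau>) (event S \<tau>)"
    unfolding safe_def by blast+
  have avg_nonpos: "frame_avg T r u \<le> 0" if "\<And>\<tau>. u \<tau> \<le> 0" for u
    unfolding frame_avg_def using that by (intro mult_nonneg_nonpos sum_nonpos) auto
  have "frame_y S T r a l + costg S l (frame_x S T r a) \<le> 0" if l: "l \<in> {1..numL S}" for l
  proof -
    have "frame_y S T r a l + costg S l (frame_x S T r a)
        \<le> frame_y S T r a l + frame_avg T r (\<lambda>\<tau>. costg S l (xvec S (a \<tau>) (event S \<tau>)))"
      using frame_x_box_Xset(3)[OF T, of r a, OF act costg_convex[OF l]] by simp
    also have "\<dots> = frame_avg T r (\<lambda>\<tau>. yhat S l (a \<tau>) (event S \<tau>) + costg S l (xvec S (a \<tau>) (event S \<tau>)))"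
      by (simp add: frame_y_def frame_avg_def sum.distrib add_divide_distrib)
    also have "\<dots> \<le> 0" by (rule avg_nonpos) (rule g[OF l])
    finally show ?thesis .
  qed
  moreover have "frame_avg T r (\<lambda>\<tau>. ahat S k (a \<tau>) (event S \<tau>) - bhat S k (a \<tau>) (event S \<tau>)) \<le> 0"
    if "k \<in> {1..numK S}" for k
    by (rule avg_nonpos) (simp add: ab[OF that])
  moreover have "frame_x S T r a \<in> Xset S" by (rule frame_x_box_Xset(2)[OF T act X])
  ultimately show ?thesis using act unfolding lookahead_feasible_def by blast
qed

text \<open>With a fixed queue vector the weights come out of the sum over the frame, which leaves
  \<open>T\<close> times the lookahead constraints: nonpositive against the nonnegative
  \<open>Z\<close> and \<open>Q\<close>. For \<open>H\<close> the sum is exactly zero because the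
  auxiliary vector is the average of \<open>xhat\<close>, so no sign is required there.\<close>

lemma sum_decision_cost_lookahead_nonpos:
  assumes T: "T > 0" and a: "lookahead_feasible S T r a"
    and Z: "\<And>l. l \<in> {1..numL S} \<Longrightarrow> 0 \<le> Zq \<theta> l" and Q: "\<And>k. k \<in> {1..numK S} \<Longrightarrow> 0 \<le> Qq \<theta> k"
  shows "(\<Sum>\<tau>\<in>{r * T..<(r + 1) * T}. decision_cost S 0 \<tau> \<theta> (a \<tau>) (frame_x S T r a)) \<le> 0"
proof -
  let ?I = "{r * T..<(r + 1) * T}" and ?g = "frame_x S T r a"
  have card: "card ?I = T" by simp
  have sum_eq: "(\<Sum>\<tau>\<in>?I. u \<tau>) = real T * frame_avg T r u" for u
    using T by (simp add: frame_avg_def)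
  have Zsum: "(\<Sum>\<tau>\<in>?I. yhat S l (a \<tau>) (event S \<tau>) + costg S l ?g) \<le> 0" if "l \<in> {1..numL S}" for l
  proof -
    have "(\<Sum>\<tau>\<in>?I. yhat S l (a \<tau>) (event S \<tau>) + costg S l ?g)
        = real T * (frame_y S T r a l + costg S l ?g)"
      unfolding sum.distrib frame_y_def distrib_left sum_eq[symmetric] sum_constant card ..
    then show ?thesis using a that unfolding lookahead_feasible_def by (auto intro: mult_nonneg_nonpos)
  qed
  have Qsum: "(\<Sum>\<tau>\<in>?I. ahat S k (a \<tau>) (event S \<tau>) - bhat S k (a \<tau>) (event S \<tau>)) \<le> 0"
    if "k \<in> {1..numK S}" for k
    using a that unfolding sum_eq lookahead_feasible_def by (auto intro: mult_nonneg_nonpos)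
  have Hsum: "(\<Sum>\<tau>\<in>?I. ?g m - xhat S m (a \<tau>) (event S \<tau>)) = 0" if "m \<in> {1..numM S}" for m
    using that T unfolding sum_subtractf sum_constant card by (simp add: frame_x_def frame_avg_def)
  have "(\<Sum>\<tau>\<in>?I. \<Sum>l\<in>{1..numL S}. Zq \<theta> l * (yhat S l (a \<tau>) (event S \<tau>) + costg S l ?g)) \<le> 0"
    by (subst sum.swap, unfold sum_distrib_left[symmetric])
      (rule sum_nonpos, rule mult_nonneg_nonpos, erule Z, erule Zsum)
  moreover have "(\<Sum>\<tau>\<in>?I. \<Sum>k\<in>{1..numK S}. Qq \<theta> k * (ahat S k (a \<tau>) (event S \<tau>) - bhat S k (a \<tau>) (event S \<tau>))) \<le> 0"
    by (subst sum.swap, unfold sum_distrib_left[symmetric])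
      (rule sum_nonpos, rule mult_nonneg_nonpos, erule Q, erule Qsum)
  moreover have "(\<Sum>\<tau>\<in>?I. \<Sum>m\<in>{1..numM S}. Hq \<theta> m * (?g m - xhat S m (a \<tau>) (event S \<tau>))) = 0"
    by (subst sum.swap, unfold sum_distrib_left[symmetric])
      (intro sum.neutral ballI, simp only: Hsum mult_zero_right)
  ultimately show ?thesis unfolding decision_cost_def Let_def sum.distrib mult_zero_left by simp
qed

section \<open>Cost over one frame and over R frames\<close>

lemma frame_cost_le:
  assumes T: "T > 0" and B: "valid_B S B" and D: "valid_D S D" and a: "lookahead_feasible S T r a"
  shows "lyapunov S (\<Theta> ((r + 1) * T)) - lyapunov S (\<Theta> (r * T))
      + V * (\<Sum>\<tau>\<in>{r * T..<(r + 1) * T}. yhat S 0 (\<alpha> \<tau>) (event S \<tau>) + costf S (\<gamma> \<tau>))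
    \<le> real T * (B + C) + D * (real T * (real T - 1))
      + V * real T * (frame_y S T r a 0 + costf S (frame_x S T r a))"
proof -
  let ?I = "{r * T..<(r + 1) * T}" and ?g = "frame_x S T r a"
  have card: "card ?I = T" by simp
  have act: "\<And>\<tau>. \<tau> \<in> ?I \<Longrightarrow> a \<tau> \<in> action_set S (event S \<tau>)" and "?g \<in> Xset S"
    using a unfolding lookahead_feasible_def by blast+
  then have feas: "(a \<tau>, ?g) \<in> feasible_pairs S \<tau>" if "\<tau> \<in> ?I" for \<tau>
    using that frame_x_box_Xset(1)[OF T act] unfolding feasible_pairs_def by blast
  have "lyapunov S (\<Theta> ((r + 1) * T)) - lyapunov S (\<Theta> (r * T))
      + V * (\<Sum>\<tau>\<in>?I. yhat S 0 (\<alpha> \<tau>) (event S \<tau>) + costf S (\<gamma> \<tau>))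
      = (\<Sum>\<tau>\<in>?I. lyapunov S (\<Theta> (Suc \<tau>)) - lyapunov S (\<Theta> \<tau>)
          + V * (yhat S 0 (\<alpha> \<tau>) (event S \<tau>) + costf S (\<gamma> \<tau>)))"
    unfolding sum.distrib[of "\<lambda>\<tau>. lyapunov S (\<Theta> (Suc \<tau>)) - lyapunov S (\<Theta> \<tau>)"] sum_distrib_left
    by (subst sum_Suc_diff') simp_all
  also have "\<dots> \<le> (\<Sum>\<tau>\<in>?I. B + C + V * (yhat S 0 (a \<tau>) (event S \<tau>) + costf S ?g)
      + (decision_cost S 0 \<tau> (\<Theta> (r * T)) (a \<tau>) ?g + real (\<tau> - r * T) * (2 * D)))"
  proof (rule sum_mono)
    fix \<tau> assume \<tau>: "\<tau> \<in> ?I"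
    \<comment> \<open>Natural subtraction is exact here, since \<tau> is not before the start of the
      frame.\<close>
    then have eq: "r * T + (\<tau> - r * T) = \<tau>" by simp
    have "decision_cost S 0 \<tau> (\<Theta> \<tau>) (a \<tau>) ?g
        \<le> decision_cost S 0 \<tau> (\<Theta> (r * T)) (a \<tau>) ?g + real (\<tau> - r * T) * (2 * D)"
      using decision_cost_stale_queues[OF D, of "a \<tau>" ?g "r * T" "\<tau> - r * T"] feas[OF \<tau>]
      unfolding eq by blast
    then show "lyapunov S (\<Theta> (Suc \<tau>)) - lyapunov S (\<Theta> \<tau>)
          + V * (yhat S 0 (\<alpha> \<tau>) (event S \<tau>) + costf S (\<gamma> \<tau>))
        \<le> B + C + V * (yhat S 0 (a \<tau>) (event S \<tau>) + costf S ?g)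
          + (decision_cost S 0 \<tau> (\<Theta> (r * T)) (a \<tau>) ?g + real (\<tau> - r * T) * (2 * D))"
      using drift_plus_penalty[OF B feas[OF \<tau>]] by linarith
  qed
  also have "\<dots> = real T * (B + C) + V * (\<Sum>\<tau>\<in>?I. yhat S 0 (a \<tau>) (event S \<tau>) + costf S ?g)
      + ((\<Sum>\<tau>\<in>?I. decision_cost S 0 \<tau> (\<Theta> (r * T)) (a \<tau>) ?g) + (\<Sum>\<tau>\<in>?I. real (\<tau> - r * T)) * (2 * D))"
    by (simp only: sum.distrib sum_distrib_left sum_distrib_right sum_constant card distrib_left) (simp only: add_ac mult_ac)
  also have "(\<Sum>\<tau>\<in>?I. yhat S 0 (a \<tau>) (event S \<tau>) + costf S ?g)
      = real T * (frame_y S T r a 0 + costf S ?g)"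
    using T by (simp add: sum.distrib frame_y_def frame_avg_def distrib_left)
  also have "(\<Sum>\<tau>\<in>?I. real (\<tau> - r * T)) * (2 * D) = D * (real T * (real T - 1))"
    unfolding sum_frame_index by simp
  finally show ?thesis
    using sum_decision_cost_lookahead_nonpos[OF T a Z_nonneg Q_nonneg, of "r * T"]
    unfolding mult.assoc[of V] by linarith
qed

text \<open>The infimum need not be attained, so the bound is solved for the lookahead cost first;
  it then bounds every feasible value from below, and therefore \<open>F_star\<close>.\<close>

lemma frame_cost_le_F_star:
  assumes T: "T > 0" and B: "valid_B S B" and D: "valid_D S D"
  shows "lyapunov S (\<Theta> ((r + 1) * T)) - lyapunov S (\<Theta> (r * T))
      + V * (\<Sum>\<tau>\<in>{r * T..<(r + 1) * T}. yhat S 0 (\<alpha> \<tau>) (event S \<tau>) + costf S (\<gamma> \<tau>))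
    \<le> real T * (B + C) + D * (real T * (real T - 1)) + V * real T * F_star S T r"
    (is "?lhs \<le> ?c + V * real T * _")
proof -
  have VT: "0 < V * real T" using V T by simp
  have "(?lhs - ?c) / (V * real T) \<le> F_star S T r"
    unfolding F_star_def
  proof (rule cINF_greatest)
    fix a assume "a \<in> {a. lookahead_feasible S T r a}"
    then have "?lhs \<le> ?c + V * real T * (frame_y S T r a 0 + costf S (frame_x S T r a))"
      using frame_cost_le[OF T B D] by simp
    then have "?lhs - ?c \<le> (frame_y S T r a 0 + costf S (frame_x S T r a)) * (V * real T)"
      by (simp only: mult.commute diff_le_eq add.commute)
    then show "(?lhs - ?c) / (V * real T) \<le> frame_y S T r a 0 + costf S (frame_x S T r a)"
      using VT by (simp only: pos_divide_le_eq)
  qed (use exists_lookahead_feasible[OF T] in auto)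
  then have "?lhs - ?c \<le> F_star S T r * (V * real T)" using VT by (simp only: pos_divide_le_eq)
  then show ?thesis by (simp only: mult.commute diff_le_eq add.commute)
qed

lemma cost_le_lookahead:
  assumes T: "T > 0" and R: "R > 0" and B: "valid_B S B" and D: "valid_D S D"
  shows "ybar S \<alpha> (R * T) 0 + costf S (xbar S \<alpha> (R * T))
    \<le> 1 / real R * (\<Sum>r<R. F_star S T r) + (B + C) / V + D * (real T - 1) / V
      + lyapunov S (\<Theta> 0) / (V * real R * real T)
      + (\<Sum>m\<in>{1..numM S}. nu S m * \<bar>Hq (\<Theta> (R * T)) m - Hq (\<Theta> 0) m\<bar> / (real R * real T))"
proof -
  let ?u = "\<lambda>\<tau>. yhat S 0 (\<alpha> \<tau>) (event S \<tau>) + costf S (\<gamma> \<tau>)"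
  have RT: "0 < V * real R * real T" using V R T by simp
  \<comment> \<open>The first \<open>R * T\<close> slots are cut into \<open>R\<close> consecutive
    frames.\<close>
  have "(\<Sum>\<tau><R * T. ?u \<tau>) = (\<Sum>r<R. \<Sum>\<tau>\<in>{r * T..<(r + 1) * T}. ?u \<tau>)"
    unfolding sum.nat_group[symmetric] by (simp add: add.commute)
  moreover have "lyapunov S (\<Theta> (R * T)) - lyapunov S (\<Theta> 0)
      = (\<Sum>r<R. lyapunov S (\<Theta> ((r + 1) * T)) - lyapunov S (\<Theta> (r * T)))"
    using sum_lessThan_telescope[of "\<lambda>r. lyapunov S (\<Theta> (r * T))" R] by simp
  ultimately have "lyapunov S (\<Theta> (R * T)) - lyapunov S (\<Theta> 0) + V * (\<Sum>\<tau><R * T. ?u \<tau>)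
      = (\<Sum>r<R. lyapunov S (\<Theta> ((r + 1) * T)) - lyapunov S (\<Theta> (r * T))
          + V * (\<Sum>\<tau>\<in>{r * T..<(r + 1) * T}. ?u \<tau>))"
    by (simp only: sum.distrib[of "\<lambda>r. lyapunov S (\<Theta> ((r + 1) * T)) - lyapunov S (\<Theta> (r * T))"] sum_distrib_left[of V _ "{..<R}"])
  also have "\<dots> \<le> (\<Sum>r<R. real T * (B + C) + D * (real T * (real T - 1)) + V * real T * F_star S T r)"
    by (intro sum_mono frame_cost_le_F_star T B D)
  also have "\<dots> = real R * (real T * (B + C) + D * (real T * (real T - 1)))
      + V * real T * (\<Sum>r<R. F_star S T r)"
    by (simp add: sum.distrib sum_distrib_left)
  finally have "V * (\<Sum>\<tau><R * T. ?u \<tau>) \<le> real R * (real T * (B + C) + D * (real T * (real T - 1)))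
      + V * real T * (\<Sum>r<R. F_star S T r) + lyapunov S (\<Theta> 0)"
  proof -
    \<comment> \<open>The final Lyapunov value is dropped by its sign; only the initial one
      survives.\<close>
    have "0 \<le> lyapunov S (\<Theta> (R * T))" unfolding lyapunov_def
      by (intro add_nonneg_nonneg mult_nonneg_nonneg sum_nonneg) auto
    moreover assume "lyapunov S (\<Theta> (R * T)) - lyapunov S (\<Theta> 0) + V * (\<Sum>\<tau><R * T. ?u \<tau>)
      \<le> real R * (real T * (B + C) + D * (real T * (real T - 1))) + V * real T * (\<Sum>r<R. F_star S T r)"
    ultimately show ?thesis by linarith
  qed
  then have "V * (\<Sum>\<tau><R * T. ?u \<tau>) / (V * real R * real T)
      \<le> (real R * (real T * (B + C) + D * (real T * (real T - 1)))
        + V * real T * (\<Sum>r<R. F_star S T r) + lyapunov S (\<Theta> 0)) / (V * real R * real T)"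
    using RT by (intro divide_right_mono) auto
  \<comment> \<open>The accumulated freezing error \<open>R * D * T * (T - 1)\<close> divided by
    \<open>V * R * T\<close> leaves \<open>D * (T - 1) / V\<close>.\<close>
  also have "\<dots> = 1 / real R * (\<Sum>r<R. F_star S T r) + (B + C) / V + D * (real T - 1) / V
      + lyapunov S (\<Theta> 0) / (V * real R * real T)"
    using V R T by (simp add: field_simps)
  also have "V * (\<Sum>\<tau><R * T. ?u \<tau>) / (V * real R * real T)
      = ybar S \<alpha> (R * T) 0 + time_avg (R * T) (\<lambda>\<tau>. costf S (\<gamma> \<tau>))"
    using V by (simp add: ybar_def time_avg_def sum.distrib add_divide_distrib mult.assoc)
  finally show ?thesis
    using cost_xbar_le[of "costf S" "nu S" "R * T"] costs R T
    unfolding cost_assumptions_def of_nat_mult by auto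
qed

lemma empty_queues_nu_sum_le:
  assumes "valid_B S B" "C0 = sqrt (2 * drift_bound B)" "all_queues_empty S (\<Theta> 0)" "T > 0" "R > 0"
  shows "(\<Sum>m\<in>{1..numM S}. nu S m * \<bar>Hq (\<Theta> (R * T)) m - Hq (\<Theta> 0) m\<bar> / (real R * real T))
    \<le> (\<Sum>m\<in>{1..numM S}. nu S m * C0 * sqrt (V / (real R * real T)))"
proof (rule sum_mono)
  fix m assume m: "m \<in> {1..numM S}"
  then have "0 \<le> nu S m" using costs unfolding cost_assumptions_def regular_cost_def by blast
  then have "nu S m * (\<bar>Hq (\<Theta> (R * T)) m - Hq (\<Theta> 0) m\<bar> / real (R * T))
      \<le> nu S m * (C0 * sqrt (V / real (R * T)))"
    using empty_queues_div_le(3)[OF assms(1,2,3) _ m, of "R * T"] assms(4,5)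
    by (intro mult_left_mono) auto
  then show "nu S m * \<bar>Hq (\<Theta> (R * T)) m - Hq (\<Theta> 0) m\<bar> / (real R * real T)
      \<le> nu S m * C0 * sqrt (V / (real R * real T))"
    by (simp add: mult.assoc)
qed

end

section \<open>Assembly of the bounds on queues, constraints and cost\<close>

theorem theorem1:
  fixes S :: "('a, 'w) system"
    and V C :: real
    and \<alpha> :: "nat \<Rightarrow> 'a"
    and \<gamma> :: "nat \<Rightarrow> nat \<Rightarrow> real"
    and \<Theta> :: "nat \<Rightarrow> queues"
  assumes "V > 0" and "C \<ge> 0"
    and "convex_constraint_set S"
    and "assumption_A1 S"
    and "cost_assumptions S"
    and "assumption_A2 S"
    and "queue_dynamics S \<alpha> \<gamma> \<Theta>"
    and "C_approximate S V C \<alpha> \<gamma> \<Theta>"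
  shows
    "(\<exists>B. valid_B S B) \<and> (\<exists>D. valid_D S D) \<and>
     (\<forall>B D C0. valid_B S B \<longrightarrow> valid_D S D \<longrightarrow>
        C0 = sqrt (2 * ((B + C) / V + (y_max S 0 - y_min S 0) + (f_max S - f_min S))) \<longrightarrow>
       \<comment> \<open>(a)\<close>
       (\<forall>t::nat. t > 0 \<longrightarrow>
          (\<Sum>l\<in>{1..numL S}. (Zq (\<Theta> t) l)\<^sup>2) + (\<Sum>k\<in>{1..numK S}. (Qq (\<Theta> t) k)\<^sup>2)
            + (\<Sum>m\<in>{1..numM S}. (Hq (\<Theta> t) m)\<^sup>2)
            \<le> real t * V * C0\<^sup>2 + 2 * lyapunov S (\<Theta> 0) \<and>
          (\<forall>l\<in>{1..numL S}. Zq (\<Theta> t) l \<le> sqrt (real t * V * C0\<^sup>2 + 2 * lyapunov S (\<Theta> 0))) \<and>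
          (\<forall>k\<in>{1..numK S}. Qq (\<Theta> t) k \<le> sqrt (real t * V * C0\<^sup>2 + 2 * lyapunov S (\<Theta> 0))) \<and>
          (\<forall>m\<in>{1..numM S}. \<bar>Hq (\<Theta> t) m\<bar> \<le> sqrt (real t * V * C0\<^sup>2 + 2 * lyapunov S (\<Theta> 0))) \<and>
          (all_queues_empty S (\<Theta> 0) \<longrightarrow>
             sqrt (real t * V * C0\<^sup>2 + 2 * lyapunov S (\<Theta> 0)) = C0 * sqrt (real t * V))) \<and>
       \<comment> \<open>(b)\<close>
       (all_queues_empty S (\<Theta> 0) \<longrightarrow> (\<forall>t_end::nat. t_end > 0 \<longrightarrow>
          (\<forall>l\<in>{1..numL S}. ybar S \<alpha> t_end l + costg S l (xbar S \<alpha> t_end)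
             \<le> C0 * sqrt (V / real t_end) * (1 + (\<Sum>m\<in>{1..numM S}. beta S l m))) \<and>
          (\<forall>k\<in>{1..numK S}. abar S \<alpha> t_end k \<le> bbar S \<alpha> t_end k + C0 * sqrt (V / real t_end)) \<and>
          (\<exists>\<epsilon>::nat \<Rightarrow> real.
             (\<forall>m\<in>{1..numM S}. \<bar>\<epsilon> m\<bar> \<le> C0 * sqrt (V / real t_end)) \<and>
             (\<lambda>m\<in>{1..numM S}. xbar S \<alpha> t_end m + \<epsilon> m) \<in> Xset S))) \<and>
       \<comment> \<open>(c)\<close>
       (\<forall>T R :: nat. T > 0 \<longrightarrow> R > 0 \<longrightarrow>
          ybar S \<alpha> (R * T) 0 + costf S (xbar S \<alpha> (R * T))
            \<le> 1 / real R * (\<Sum>r<R. F_star S T r) + (B + C) / V + D * (real T - 1) / V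
              + lyapunov S (\<Theta> 0) / (V * real R * real T)
              + (\<Sum>m\<in>{1..numM S}. nu S m * \<bar>Hq (\<Theta> (R * T)) m - Hq (\<Theta> 0) m\<bar> / (real R * real T)) \<and>
          (all_queues_empty S (\<Theta> 0) \<longrightarrow>
             (\<Sum>m\<in>{1..numM S}. nu S m * \<bar>Hq (\<Theta> (R * T)) m - Hq (\<Theta> 0) m\<bar> / (real R * real T))
               \<le> (\<Sum>m\<in>{1..numM S}. nu S m * C0 * sqrt (V / (real R * real T))))))"
proof -
  interpret approximate_run S V C \<alpha> \<gamma> \<Theta> using assms by unfold_locales
  show ?thesis
  \<comment> \<open>Cases 1 to 5 belong to (a), 6 to 8 to (b), and 9 and 10 to (c). Unfolding
    \<open>drift_bound\<close> identifies the given \<open>C0\<close> with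
    \<open>sqrt (2 * drift_bound B)\<close>.\<close>
  proof (intro conjI exists_valid_B exists_valid_D allI impI, goal_cases)
    case (1 B D C0 t)
    then show ?case using sum_squares_queues_le[of B C0 t] by (simp add: drift_bound_def)
  next
    case (2 B D C0 t)
    then show ?case using abs_queues_le(1)[of B C0 _ t] by (force simp: drift_bound_def)
  next
    case (3 B D C0 t)
    then show ?case using abs_queues_le(2)[of B C0 _ t] by (force simp: drift_bound_def)
  next
    case (4 B D C0 t)
    then show ?case using abs_queues_le(3)[of B C0 _ t] by (force simp: drift_bound_def)
  next
    case (5 B D C0 t)
    then show ?case using empty_queue_bound[of B C0 t] by (simp add: drift_bound_def)
  next
    case (6 B D C0 n)
    then show ?case using time_average_constraints(1)[of B C0 n] by (simp add: drift_bound_def)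
  next
    case (7 B D C0 n)
    then show ?case using time_average_constraints(2)[of B C0 n] by (simp add: drift_bound_def)
  next
    case (8 B D C0 n)
    then show ?case using time_average_constraints(3)[of B C0 n] by (simp add: drift_bound_def)
  next
    case (9 B D C0 T R)
    then show ?case by (intro cost_le_lookahead)
  next
    case (10 B D C0 T R)
    then show ?case by (intro empty_queues_nu_sum_le[of B]) (simp_all add: drift_bound_def)
  qed
qed

end
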